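(* Let $E\subset\mathbb{R}$ be a cubic number field and let $\alpha,\beta\in E$ be such that $(1,\alpha,\beta)$ is a basis of $E$ over $\mathbb{Q}$. For each positive integer $D$ let $\psi(D)=D\prod_{p\mid D}(p^6-1)$, the product over the primes $p$ dividing $D$. (a) If $E$ has exactly one real embedding, then there are constants $C,C'>0$ depending only on $\alpha,\beta$ such that for every $0<\epsilon\le1$ and every positive integer $D$ there exists a triple of integers $(Q,R,S)$ with $Q>1$ and $\gcd(Q,R,S)=1$ satisfying $$|Q\alpha-R|\le\epsilon Q^{-1/2},\qquad |Q\beta-S|\le CQ^{-1/2},\qquad Q\equiv R\equiv0\pmod D,$$ and $\log Q\le C'\epsilon^{-1}\psi(D)$. (b) If $E$ is totally real, then the same holds with the bound $\log Q\le C'\epsilon^{-1}\psi(D)^2$ in place of $\log Q\le C'\epsilon^{-1}\psi(D)$. *)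

theory Defs
  imports
    Complex_Main
    "HOL-Algebra.Algebraic_Closure_Type"
    "HOL-Number_Theory.Cong"
begin

definition cubic_number_field :: "real set \<Rightarrow> bool"
  where "cubic_number_field E \<longleftrightarrow>
    subfield E ring_of_type_algebra \<and> ring.dimension ring_of_type_algebra 3 \<rat> E"

definition rat_basis :: "real list \<Rightarrow> real set \<Rightarrow> bool"
  where "rat_basis us E \<longleftrightarrow>
    ring.independent ring_of_type_algebra \<rat> us \<and> ring.Span ring_of_type_algebra \<rat> us = E"

text \<open>
  The maps in \<^const>\<open>ring_hom\<close> are unconstrained outside the carrier; taking them
  extensional makes each embedding of \<open>E\<close> occur exactly once, so that embeddings can be counted.
\<close>

definition embeddings :: "real set \<Rightarrow> (real \<Rightarrow> 'a :: field) set"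
  where "embeddings E =
    ring_hom (ring_of_type_algebra\<lparr>carrier := E\<rparr>) ring_of_type_algebra \<inter> extensional E"

definition one_real_embedding :: "real set \<Rightarrow> bool"
  where "one_real_embedding E \<longleftrightarrow> card (embeddings E :: (real \<Rightarrow> real) set) = 1"

definition totally_real :: "real set \<Rightarrow> bool"
  where "totally_real E \<longleftrightarrow> (\<forall>\<sigma> \<in> (embeddings E :: (real \<Rightarrow> complex) set). \<sigma> ` E \<subseteq> \<real>)"

definition psi :: "nat \<Rightarrow> real"
  where "psi D = real D * (\<Prod>p \<in> {p. prime p \<and> p dvd D}. (real p ^ 6 - 1))"

end

(*
  Choose an order Z[g] of E, with g an integer multiple of alpha, that stabilises the lattice spanned by
  1, alpha, beta, and let tau be the beta-coordinate. For a unit eta = 1 (mod D) of the order put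
  (Q, R, S) = (tau eta, tau (eta alpha), tau (eta beta)). For eta = 1 this is (0, 0, 1), so D divides Q and
  R; the gcd is 1 because eta is invertible; and Q alpha - R is a constant times the difference of the two
  conjugates of eta.
  It remains to find a large eta whose conjugates nearly agree. Frobenius modulo p shows that
  every 2 psi(D)-th power of a unit is 1 modulo D. In the complex case Dirichlet's approximation
  theorem, applied to the argument of a conjugate of a unit, gives an exponent of size psi(D)/epsilon. In the
  totally real case it is applied to the logarithms of the ratios of the conjugates of two units; they have to
  be matched up to epsilon/psi(D), which costs the second factor psi(D). The units needed come from the
  pigeonhole principle.
*)
theory Submission
  imports Defs "HOL-Analysis.Kronecker_Approximation_Theorem" "HOL-Number_Theory.Residues"
begin

section \<open>The exponent of the unit group modulo an integer\<close>

text \<open>The order need not be maximal, so ideals of it do not factor uniquely; facts about its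
  quotient by p are obtained from polynomial identities inside the order. Every element satisfies an
  integer cubic, and the roots of a cubic over F_p have degree 1, 2 or 3: this is where 6 = lcm(1,
  2, 3) in p^6 - 1 comes from. Nilpotents modulo p cannot be excluded either and cost the further
  power of p in the exponent. The two cases differ because an argument counts only modulo 2 pi. In
  the complex case the exponent 2 psi(D) can be absorbed into the number handed to Dirichlet's
  theorem and loses no accuracy. Logarithms have no period, so the same exponent multiplies the
  error, and this loss has to be compensated beforehand by larger exponents of the two units. The
  decay Q^(-1/2) is the norm equation: \<eta> times its two conjugates is 1 in absolute value, so
  conjugates of nearly equal modulus have size about |\<eta>|^(-1/2), while Q is of the order of
  \<eta>.\<close>

definition cubic_order :: "real \<Rightarrow> real set"
  where "cubic_order \<gamma> = {of_int x + of_int y * \<gamma> + of_int z * \<gamma>\<^sup>2 | x y z. True}"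

lemma cubic_orderI: "of_int x + of_int y * \<gamma> + of_int z * \<gamma>\<^sup>2 \<in> cubic_order \<gamma>"
  by (auto simp: cubic_order_def)

lemma cubic_orderE:
  assumes "u \<in> cubic_order \<gamma>"
  obtains x y z where "u = of_int x + of_int y * \<gamma> + of_int z * \<gamma>\<^sup>2"
  using assms by (auto simp: cubic_order_def)

lemma fermat_int:
  assumes "prime p"
  shows "int p dvd e ^ p - e"
proof -
  have p: "p > 0" using assms by (simp add: prime_gt_0_nat)
  have "[e ^ p = e] (mod int p)"
  proof (cases "int p dvd e")
    case True
    then have "int p dvd e ^ p" using p by (meson dvd_power dvd_trans)
    with True show ?thesis by (metis cong_0_iff cong_sym cong_trans)
  next
    case False
    define r where "r = nat (e mod int p)"
    have r: "int r = e mod int p" using p by (simp add: r_def)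
    then have "\<not> p dvd r" using False
      by (metis dvd_mod_iff dvd_refl int_dvd_int_iff)
    from fermat_theorem[OF assms this] have "[r ^ (p - 1) * r = 1 * r] (mod p)"
      by (rule cong_mult) simp
    then have "[r ^ p = r] (mod p)"
      using p by (cases p) (simp_all add: mult.commute)
    then have "[int r ^ p = int r] (mod int p)"
      by (metis cong_int_iff of_nat_power)
    moreover have "[e = int r] (mod int p)" by (simp add: r cong_def)
    ultimately show ?thesis
      by (meson cong_pow cong_sym cong_trans)
  qed
  then show ?thesis by (simp add: cong_iff_dvd_diff)
qed

text \<open>Expand the determinant along the first column and use that the eigenvector \<open>(1, g, h)\<close> has
  first entry \<open>1\<close>.\<close>

lemma cayley_hamilton_3:
  fixes u g h :: "'a :: comm_ring_1"
  assumes "u = x + y * g + z * h" "u * g = x' + y' * g + z' * h" "u * h = x'' + y'' * g + z'' * h"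
  shows "u ^ 3 = (x + y' + z'') * u\<^sup>2 - (x * y' - y * x' + x * z'' - z * x'' + y' * z'' - z' * y'') * u
    + (x * (y' * z'' - z' * y'') - y * (x' * z'' - z' * x'') + z * (x' * y'' - y' * x''))"
    (is "_ = ?rhs")
proof -
  have "?rhs - u ^ 3 = ((y' - u) * (z'' - u) - z' * y'') * (x + y * g + z * h - u)
    + (z * y'' - y * (z'' - u)) * (x' + y' * g + z' * h - u * g)
    + (y * z' - z * (y' - u)) * (x'' + y'' * g + z'' * h - u * h)"
    by (simp add: algebra_simps power2_eq_square power3_eq_cube)
  also have "\<dots> = 0"
    using assms by simp
  finally show ?thesis by simp
qed

text \<open>\<open>root\<close> closes \<open>cubic_order \<gamma>\<close> under multiplication;
  \<open>indep\<close> makes coordinates unique, so that divisibility in the order can be tested on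
  three integers.\<close>

locale integral_cubic =
  fixes \<gamma> :: real and a b c :: int
  assumes root: "\<gamma> ^ 3 = of_int a * \<gamma>\<^sup>2 + of_int b * \<gamma> + of_int c"
    and indep: "of_int x + of_int y * \<gamma> + of_int z * \<gamma>\<^sup>2 = 0 \<Longrightarrow> x = 0 \<and> y = 0 \<and> z = 0"
begin

abbreviation \<O> where "\<O> \<equiv> cubic_order \<gamma>"

lemma O_of_int [simp]: "of_int n \<in> \<O>"
  using cubic_orderI[of n 0 _ 0] by simp

lemma O_0 [simp]: "0 \<in> \<O>" and O_1 [simp]: "1 \<in> \<O>"
  using O_of_int[of 0] O_of_int[of 1] by simp_all

lemma O_of_nat [simp]: "of_nat n \<in> \<O>"
  using O_of_int[of "int n"] by simp

lemma O_gamma [simp]: "\<gamma> \<in> \<O>"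
  using cubic_orderI[of 0 1 _ 0] by simp

lemma O_add [simp]: "u \<in> \<O> \<Longrightarrow> v \<in> \<O> \<Longrightarrow> u + v \<in> \<O>"
proof (elim cubic_orderE)
  fix x y z x' y' z'
  assume "u = of_int x + of_int y * \<gamma> + of_int z * \<gamma>\<^sup>2" "v = of_int x' + of_int y' * \<gamma> + of_int z' * \<gamma>\<^sup>2"
  then show ?thesis
    using cubic_orderI[of "x + x'" "y + y'" \<gamma> "z + z'"] by (simp add: algebra_simps)
qed

lemma O_uminus [simp]: "u \<in> \<O> \<Longrightarrow> - u \<in> \<O>"
proof (elim cubic_orderE)
  fix x y z
  assume "u = of_int x + of_int y * \<gamma> + of_int z * \<gamma>\<^sup>2"
  then show ?thesis
    using cubic_orderI[of "- x" "- y" \<gamma> "- z"] by (simp add: algebra_simps)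
qed

lemma O_diff [simp]: "u \<in> \<O> \<Longrightarrow> v \<in> \<O> \<Longrightarrow> u - v \<in> \<O>"
  using O_add[of u "- v"] by simp

lemma O_mult_gamma: "u \<in> \<O> \<Longrightarrow> u * \<gamma> \<in> \<O>"
proof (elim cubic_orderE)
  fix x y z
  assume u: "u = of_int x + of_int y * \<gamma> + of_int z * \<gamma>\<^sup>2"
  have "u * \<gamma> = of_int x * \<gamma> + of_int y * \<gamma>\<^sup>2 + of_int z * \<gamma> ^ 3"
    unfolding u by (simp add: algebra_simps power2_eq_square power3_eq_cube)
  also have "\<dots> = of_int (z * c) + of_int (x + z * b) * \<gamma> + of_int (y + z * a) * \<gamma>\<^sup>2"
    unfolding root by (simp add: algebra_simps)
  finally show ?thesis using cubic_orderI by metis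
qed

lemma O_mult_of_int: "u \<in> \<O> \<Longrightarrow> u * of_int n \<in> \<O>"
proof (elim cubic_orderE)
  fix x y z
  assume "u = of_int x + of_int y * \<gamma> + of_int z * \<gamma>\<^sup>2"
  then show ?thesis
    using cubic_orderI[of "x * n" "y * n" \<gamma> "z * n"] by (simp add: algebra_simps)
qed

lemma O_mult [simp]:
  assumes u: "u \<in> \<O>" and "v \<in> \<O>"
  shows "u * v \<in> \<O>"
proof -
  obtain x y z where v: "v = of_int x + of_int y * \<gamma> + of_int z * \<gamma>\<^sup>2"
    using assms(2) by (rule cubic_orderE)
  have "u * v = u * of_int x + u * \<gamma> * of_int y + u * \<gamma> * \<gamma> * of_int z"
    unfolding v by (simp add: algebra_simps power2_eq_square)
  also have "\<dots> \<in> \<O>"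
    by (intro O_add O_mult_of_int O_mult_gamma u)
  finally show ?thesis .
qed

lemma O_power [simp]: "u \<in> \<O> \<Longrightarrow> u ^ n \<in> \<O>"
  by (induction n) auto

lemma O_sum: "(\<And>i. i \<in> A \<Longrightarrow> f i \<in> \<O>) \<Longrightarrow> sum f A \<in> \<O>"
  by (induction A rule: infinite_finite_induct) auto

text \<open>Symmetric functions of the three values, rewritten in the elementary ones of the roots:
  \<open>a\<^sup>2 + 2 * b\<close>, \<open>- (a * b + 3 * c)\<close> and
  \<open>b\<^sup>2 - 2 * a * c\<close> are the sums of t_i^2, of t_i^2 t_j with i \<noteq> j, and of
  t_i^2 t_j^2 with i < j. The point is that all three results are integers.\<close>

lemma charpoly:
  fixes x y z :: int and t0 t1 t2 :: complex
  defines "ev \<equiv> \<lambda>t. of_int x + of_int y * t + of_int z * t\<^sup>2"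
  defines "e1 \<equiv> 3 * x + a * y + (a\<^sup>2 + 2 * b) * z"
    and "e2 \<equiv> 3 * x\<^sup>2 + 2 * a * x * y + 2 * (a\<^sup>2 + 2 * b) * x * z - b * y\<^sup>2
               - (a * b + 3 * c) * y * z + (b\<^sup>2 - 2 * a * c) * z\<^sup>2"
    and "e3 \<equiv> x ^ 3 + a * x\<^sup>2 * y + (a\<^sup>2 + 2 * b) * x\<^sup>2 * z - b * x * y\<^sup>2 - (a * b + 3 * c) * x * y * z
               + (b\<^sup>2 - 2 * a * c) * x * z\<^sup>2 + c * y ^ 3 + a * c * y\<^sup>2 * z - b * c * y * z\<^sup>2 + c\<^sup>2 * z ^ 3"
  assumes t: "t0 + t1 + t2 = of_int a" "t0 * t1 + t0 * t2 + t1 * t2 = - of_int b" "t0 * t1 * t2 = of_int c"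
  shows "ev t0 + ev t1 + ev t2 = of_int e1"
    and "ev t0 * ev t1 + ev t0 * ev t2 + ev t1 * ev t2 = of_int e2"
    and "ev t0 * ev t1 * ev t2 = of_int e3"
proof -
  have a: "of_int a = t0 + t1 + t2" and b: "of_int b = - (t0 * t1 + t0 * t2 + t1 * t2)"
    and c: "of_int c = t0 * t1 * t2"
    using t by (auto simp: algebra_simps)
  note unf = of_int_add of_int_mult of_int_power of_int_diff of_int_numeral a b c power2_eq_square power3_eq_cube
  show "ev t0 + ev t1 + ev t2 = of_int e1"
    unfolding ev_def e1_def unf by (simp add: algebra_simps)
  show "ev t0 * ev t1 + ev t0 * ev t2 + ev t1 * ev t2 = of_int e2"
    unfolding ev_def e2_def unf by (simp add: algebra_simps)
  show "ev t0 * ev t1 * ev t2 = of_int e3"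
    unfolding ev_def e3_def unf by (simp add: algebra_simps)
qed

text \<open>Cayley-Hamilton for multiplication by \<open>u\<close> on the basis 1, \<gamma>,
  \<gamma>^2. The characteristic polynomial, unlike the minimal one, is a cubic even for rational
  integers.\<close>

lemma O_cubic:
  assumes "u \<in> \<O>"
  obtains e1 e2 e3 :: int where "u ^ 3 = of_int e1 * u\<^sup>2 + of_int e2 * u + of_int e3"
proof -
  have "\<exists>x y z :: int. v = of_int x + of_int y * \<gamma> + of_int z * \<gamma>\<^sup>2" if "v \<in> \<O>" for v
    using that by (auto simp: cubic_order_def)
  from this[of u] this[of "u * \<gamma>"] this[of "u * \<gamma>\<^sup>2"] assms
  obtain x y z x' y' z' x'' y'' z'' :: int where *:
    "u = of_int x + of_int y * \<gamma> + of_int z * \<gamma>\<^sup>2"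
    "u * \<gamma> = of_int x' + of_int y' * \<gamma> + of_int z' * \<gamma>\<^sup>2"
    "u * \<gamma>\<^sup>2 = of_int x'' + of_int y'' * \<gamma> + of_int z'' * \<gamma>\<^sup>2"
    by auto
  from cayley_hamilton_3[OF *] show ?thesis
    by (intro that[of "x + y' + z''" "- (x * y' - y * x' + x * z'' - z * x'' + y' * z'' - z' * y'')"
      "x * (y' * z'' - z' * y'') - y * (x' * z'' - z' * x'') + z * (x' * y'' - y' * x'')"]) (simp add: algebra_simps)
qed

section \<open>Congruences in the order modulo an integer\<close>

definition O_mod :: "nat \<Rightarrow> real set"
  where "O_mod m = (*) (real m) ` \<O>"

lemma O_modI: "t \<in> \<O> \<Longrightarrow> real m * t \<in> O_mod m"
  by (auto simp: O_mod_def)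

lemma O_mod_subset: "x \<in> O_mod m \<Longrightarrow> x \<in> \<O>"
  by (auto simp: O_mod_def)

lemma O_mod_0 [simp]: "0 \<in> O_mod m"
  using O_modI[of 0] by simp

lemma O_mod_add: "x \<in> O_mod m \<Longrightarrow> y \<in> O_mod m \<Longrightarrow> x + y \<in> O_mod m"
  by (auto simp: O_mod_def simp flip: distrib_left)

lemma O_mod_mult_right: "x \<in> O_mod m \<Longrightarrow> y \<in> \<O> \<Longrightarrow> x * y \<in> O_mod m"
  by (auto simp: O_mod_def mult.assoc)

lemma O_mod_mult_left: "x \<in> O_mod m \<Longrightarrow> y \<in> \<O> \<Longrightarrow> y * x \<in> O_mod m"
  using O_mod_mult_right[of x m y] by (simp add: mult.commute)

lemma O_mod_uminus: "x \<in> O_mod m \<Longrightarrow> - x \<in> O_mod m"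
  using O_mod_mult_right[of x m "- 1"] by simp

lemma O_mod_diff: "x \<in> O_mod m \<Longrightarrow> y \<in> O_mod m \<Longrightarrow> x - y \<in> O_mod m"
  using O_mod_add[of x m "- y"] O_mod_uminus by auto

lemma O_mod_power: "x \<in> O_mod m \<Longrightarrow> n > 0 \<Longrightarrow> x ^ n \<in> O_mod m"
  by (cases n) (auto intro!: O_mod_mult_right dest: O_mod_subset)

lemma O_mod_sum: "(\<And>i. i \<in> A \<Longrightarrow> f i \<in> O_mod m) \<Longrightarrow> sum f A \<in> O_mod m"
  by (induction A rule: infinite_finite_induct) (auto intro: O_mod_add)

text \<open>Uniqueness of coordinates (\<open>indep\<close>) reduces membership in the ideal to
  divisibility of integers, where prime factorisation is available.\<close>

lemma O_mod_coords:
  "of_int x + of_int y * \<gamma> + of_int z * \<gamma>\<^sup>2 \<in> O_mod m \<longleftrightarrow> int m dvd x \<and> int m dvd y \<and> int m dvd z"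
proof
  assume "of_int x + of_int y * \<gamma> + of_int z * \<gamma>\<^sup>2 \<in> O_mod m"
  then obtain x' y' z' where
    "of_int x + of_int y * \<gamma> + of_int z * \<gamma>\<^sup>2 = real m * (of_int x' + of_int y' * \<gamma> + of_int z' * \<gamma>\<^sup>2)"
    unfolding O_mod_def by (auto elim!: cubic_orderE)
  then have "of_int (x - m * x') + of_int (y - m * y') * \<gamma> + of_int (z - m * z') * \<gamma>\<^sup>2 = 0"
    by (simp add: algebra_simps)
  from indep[OF this] show "int m dvd x \<and> int m dvd y \<and> int m dvd z" by auto
next
  assume "int m dvd x \<and> int m dvd y \<and> int m dvd z"
  then obtain x' y' z' :: int where "x = m * x'" "y = m * y'" "z = m * z'" unfolding dvd_def by blast
  then have "of_int x + of_int y * \<gamma> + of_int z * \<gamma>\<^sup>2 = real m * (of_int x' + of_int y' * \<gamma> + of_int z' * \<gamma>\<^sup>2)"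
    by (simp add: algebra_simps)
  then show "of_int x + of_int y * \<gamma> + of_int z * \<gamma>\<^sup>2 \<in> O_mod m"
    by (metis O_modI cubic_orderI)
qed

lemma O_mod_of_int: "of_int e \<in> O_mod m \<longleftrightarrow> int m dvd e"
  using O_mod_coords[of e 0 0 m] by simp

text \<open>By Bezout an integer prime to \<open>p\<close> is invertible modulo \<open>p\<close>,
  although the quotient of the order by \<open>p\<close> need not be a field.\<close>

lemma O_mod_cancel:
  assumes "prime p" "\<not> int p dvd e" "of_int e * x \<in> O_mod p" "x \<in> \<O>"
  shows "x \<in> O_mod p"
proof -
  have "coprime e (int p)"
    using assms by (metis coprime_commute prime_imp_coprime prime_nat_int_transfer)
  then obtain s t where "s * e + t * int p = 1"
    by (metis bezout_int coprime_imp_gcd_eq_1)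
  then have one: "1 = of_int s * of_int e + of_int t * real p"
    by (metis of_int_1 of_int_add of_int_mult of_int_of_nat_eq)
  have "x = of_int s * (of_int e * x) + real p * (of_int t * x)"
    using arg_cong[OF one, of "\<lambda>r. r * x"] by (simp add: algebra_simps)
  moreover have "of_int s * (of_int e * x) + real p * (of_int t * x) \<in> O_mod p"
    by (intro O_mod_add O_mod_mult_left[OF assms(3)] O_modI O_mult O_of_int assms)
  ultimately show ?thesis by simp
qed

text \<open>Chinese remaindering, carried out on each integer coordinate by comparing
  multiplicities.\<close>

lemma O_mod_prime_powers:
  assumes "D > 0" "x \<in> \<O>" "\<And>p. prime p \<Longrightarrow> p dvd D \<Longrightarrow> x \<in> O_mod (p ^ multiplicity p D)"
  shows "x \<in> O_mod D"
proof -
  obtain r s t where x: "x = of_int r + of_int s * \<gamma> + of_int t * \<gamma>\<^sup>2"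
    using assms(2) by (rule cubic_orderE)
  have "int D dvd r" if *: "\<And>p. prime p \<Longrightarrow> p dvd D \<Longrightarrow> int (p ^ multiplicity p D) dvd r" for r
  proof (cases "r = 0")
    case False
    have "D dvd nat \<bar>r\<bar>"
    proof (rule multiplicity_le_imp_dvd)
      fix p :: nat assume p: "prime p"
      show "multiplicity p D \<le> multiplicity p (nat \<bar>r\<bar>)"
      proof (cases "p dvd D")
        case True
        have "p ^ multiplicity p D dvd nat \<bar>r\<bar>"
          using *[OF p True] int_dvd_int_iff[of "p ^ multiplicity p D" "nat \<bar>r\<bar>"] by simp
        then show ?thesis
          using False p by (intro multiplicity_geI) auto
      qed (simp add: not_dvd_imp_multiplicity_0)
    qed (use assms(1) in auto)
    then show ?thesis
      using int_dvd_int_iff[of D "nat \<bar>r\<bar>"] by simp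
  qed simp
  then show ?thesis
    using assms(3) unfolding x O_mod_coords by blast
qed

section \<open>Frobenius and nilpotents modulo a prime\<close>

lemma O_frobenius_add:
  assumes p: "prime p" and xy: "x \<in> \<O>" "y \<in> \<O>"
  shows "(x + y) ^ p - (x ^ p + y ^ p) \<in> O_mod p"
proof -
  have p0: "0 < p" using p by (simp add: prime_gt_0_nat)
  define f where "f k = of_nat (p choose k) * x ^ k * y ^ (p - k)" for k
  have "(x + y) ^ p = (\<Sum>k\<le>p. f k)"
    unfolding f_def by (rule binomial_ring)
  also have "{..p} = insert 0 (insert p {1..<p})"
    using p0 by auto
  also have "sum f \<dots> = y ^ p + x ^ p + sum f {1..<p}"
    using p0 by (simp add: f_def)
  finally have "(x + y) ^ p - (x ^ p + y ^ p) = sum f {1..<p}" by simp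
  also have "\<dots> \<in> O_mod p"
  proof (rule O_mod_sum)
    fix k assume "k \<in> {1..<p}"
    then have "p dvd (p choose k)"
      using p by (intro dvd_choose_prime) auto
    then obtain m where "p choose k = p * m" ..
    then have "f k = real p * (of_nat m * x ^ k * y ^ (p - k))"
      by (simp add: f_def)
    then show "f k \<in> O_mod p"
      using xy by (auto intro: O_modI)
  qed
  finally show ?thesis .
qed

text \<open>Additivity is applied to x - y and y, which avoids the sign (-1)^p and with it a
  separate case p = 2.\<close>

lemma O_frobenius_diff:
  assumes p: "prime p" and xy: "x \<in> \<O>" "y \<in> \<O>"
  shows "(x - y) ^ p - (x ^ p - y ^ p) \<in> O_mod p"
proof -
  have "- ((x - y + y) ^ p - ((x - y) ^ p + y ^ p)) \<in> O_mod p"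
    by (intro O_mod_uminus O_frobenius_add p O_diff xy)
  then show ?thesis by (simp add: algebra_simps)
qed

lemma O_mod_power_diff:
  assumes "x - y \<in> O_mod m" "x \<in> \<O>" "y \<in> \<O>"
  shows "x ^ n - y ^ n \<in> O_mod m"
proof -
  have "x ^ n - y ^ n = (x - y) * (\<Sum>i<n. y ^ (n - Suc i) * x ^ i)"
    by (rule power_diff_sumr2)
  also have "\<dots> \<in> O_mod m"
    by (intro O_mod_mult_right O_sum O_mult O_power assms)
  finally show ?thesis .
qed

lemma O_frobenius_diff_iter:
  assumes p: "prime p" and xy: "x \<in> \<O>" "y \<in> \<O>"
  shows "(x - y) ^ p ^ n - (x ^ p ^ n - y ^ p ^ n) \<in> O_mod p"
proof (induction n)
  case (Suc n)
  have "((x - y) ^ p ^ n) ^ p - (x ^ p ^ n - y ^ p ^ n) ^ p \<in> O_mod p"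
    by (rule O_mod_power_diff[OF Suc]) (use xy in auto)
  from O_mod_add[OF this O_frobenius_diff[OF p, of "x ^ p ^ n" "y ^ p ^ n"]]
  have "((x - y) ^ p ^ n) ^ p - ((x ^ p ^ n) ^ p - (y ^ p ^ n) ^ p) \<in> O_mod p"
    using xy by (simp add: algebra_simps)
  then show ?case
    by (simp add: mult.commute flip: power_mult)
qed simp

text \<open>The relation can be raised to the p-th power term by term modulo \<open>p\<close>, and
  Fermat's little theorem restores the coefficients. Hence all Frobenius iterates of an element are
  roots of one cubic modulo \<open>p\<close>.\<close>

lemma O_cubic_frobenius:
  assumes p: "prime p" and x: "x \<in> \<O>"
    and "x ^ 3 - (of_int e1 * x\<^sup>2 + of_int e2 * x + of_int e3) \<in> O_mod p"
  shows "(x ^ p) ^ 3 - (of_int e1 * (x ^ p)\<^sup>2 + of_int e2 * x ^ p + of_int e3) \<in> O_mod p"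
proof -
  define A B C where "A = of_int e1 * x\<^sup>2" and "B = of_int e2 * x" and "C = real_of_int e3"
  have ABC: "A \<in> \<O>" "B \<in> \<O>" "C \<in> \<O>" using x by (auto simp: A_def B_def C_def)
  have 1: "(x ^ 3) ^ p - (A + B + C) ^ p \<in> O_mod p"
    using assms(3) unfolding A_def B_def C_def by (rule O_mod_power_diff) (use x in auto)
  have 2: "(A + B + C) ^ p - ((A + B) ^ p + C ^ p) \<in> O_mod p" "(A + B) ^ p - (A ^ p + B ^ p) \<in> O_mod p"
    by (intro O_frobenius_add p O_add ABC)+
  have e: "of_int (e ^ p - e) * y \<in> O_mod p" if "y \<in> \<O>" for e y
    by (intro O_mod_mult_right that) (simp add: O_mod_of_int fermat_int p del: of_int_diff of_int_power)
  have 3: "of_int (e1 ^ p - e1) * (x ^ p)\<^sup>2 \<in> O_mod p" "of_int (e2 ^ p - e2) * x ^ p \<in> O_mod p"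
      "of_int (e3 ^ p - e3) * 1 \<in> O_mod p"
    by (intro e; use x in simp)+
  have pw: "A ^ p = of_int (e1 ^ p) * (x ^ p)\<^sup>2" "B ^ p = of_int (e2 ^ p) * x ^ p" "C ^ p = of_int (e3 ^ p)"
      "(x ^ 3) ^ p = (x ^ p) ^ 3"
    by (simp_all add: A_def B_def C_def power_mult_distrib mult.commute flip: power_mult)
  have "(x ^ p) ^ 3 - (of_int e1 * (x ^ p)\<^sup>2 + of_int e2 * x ^ p + of_int e3)
    = ((x ^ 3) ^ p - (A + B + C) ^ p) + ((A + B + C) ^ p - ((A + B) ^ p + C ^ p)) + ((A + B) ^ p - (A ^ p + B ^ p))
      + of_int (e1 ^ p - e1) * (x ^ p)\<^sup>2 + of_int (e2 ^ p - e2) * x ^ p + of_int (e3 ^ p - e3) * 1"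
    unfolding pw by (simp add: algebra_simps)
  also have "\<dots> \<in> O_mod p"
    by (intro O_mod_add 1 2 3)
  finally show ?thesis .
qed

text \<open>Over a field the Vandermonde determinant of four numbers vanishes if they are roots of a cubic; the
  identity behind this expresses it through the values of the cubic.\<close>

lemma O_mod_vandermonde:
  fixes e1 e2 e3 :: int
  defines "f \<equiv> \<lambda>t :: real. t ^ 3 - (of_int e1 * t\<^sup>2 + of_int e2 * t + of_int e3)"
  assumes t: "t0 \<in> \<O>" "t1 \<in> \<O>" "t2 \<in> \<O>" "t3 \<in> \<O>"
    and ft: "f t0 \<in> O_mod m" "f t1 \<in> O_mod m" "f t2 \<in> O_mod m" "f t3 \<in> O_mod m"
  shows "(t1 - t0) * (t2 - t1) * (t3 - t2) * (t2 - t0) * (t3 - t1) * (t3 - t0) \<in> O_mod m"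
proof -
  have "(t1 - t0) * (t2 - t1) * (t3 - t2) * (t2 - t0) * (t3 - t1) * (t3 - t0)
    = f t3 * ((t1 - t0) * (t2 - t0) * (t2 - t1)) - f t2 * ((t1 - t0) * (t3 - t0) * (t3 - t1))
      + f t1 * ((t2 - t0) * (t3 - t0) * (t3 - t2)) - f t0 * ((t2 - t1) * (t3 - t1) * (t3 - t2))"
    unfolding f_def by (simp add: algebra_simps power2_eq_square power3_eq_cube)
  also have "\<dots> \<in> O_mod m"
    by (intro O_mod_add O_mod_diff O_mod_mult_right ft O_mult O_diff t)
  finally show ?thesis .
qed

text \<open>For q = p^d and d k = 6 this makes x^(p^6) - x a multiple of x^(p^d) - x, for each
  divisor d of 6.\<close>

lemma O_power_diff_dvd:
  assumes "x \<in> \<O>"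
  obtains w where "w \<in> \<O>" "x ^ (q ^ k) - x = w * (x ^ q - x)"
proof -
  have "\<exists>w\<in>\<O>. x ^ (q ^ k) - x = w * (x ^ q - x)"
  proof (induction k)
    case 0
    show ?case by (rule bexI[of _ 0]) auto
  next
    case (Suc k)
    then obtain w where w: "w \<in> \<O>" "x ^ (q ^ k) - x = w * (x ^ q - x)" by blast
    define s where "s = (\<Sum>i<q. x ^ (q - Suc i) * (x ^ (q ^ k)) ^ i)"
    have s: "s \<in> \<O>" unfolding s_def using assms by (intro O_sum) auto
    have "x ^ (q ^ Suc k) - x = ((x ^ (q ^ k)) ^ q - x ^ q) + (x ^ q - x)"
      by (simp add: mult.commute flip: power_mult)
    also have "(x ^ (q ^ k)) ^ q - x ^ q = (x ^ (q ^ k) - x) * s"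
      unfolding s_def by (rule power_diff_sumr2)
    finally have "x ^ (q ^ Suc k) - x = (w * s + 1) * (x ^ q - x)"
      unfolding w by (simp add: algebra_simps)
    then show ?case using w s by (intro bexI[of _ "w * s + 1"]) auto
  qed
  then show ?thesis using that by blast
qed

text \<open>Frobenius permutes the at most three roots modulo a prime ideal above \<open>p\<close>, so its sixth power fixes
  them; the nilpotency exponent is the one given by the Vandermonde determinant of the first four
  Frobenius iterates.\<close>

lemma O_frobenius_6_nilpotent:
  assumes p: "prime p" and x: "x \<in> \<O>"
  shows "\<exists>m>0. (x ^ (p ^ 6) - x) ^ m \<in> O_mod p"
proof -
  obtain e1 e2 e3 where e: "x ^ 3 = of_int e1 * x\<^sup>2 + of_int e2 * x + of_int e3"
    using x by (rule O_cubic)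
  define T where "T i = x ^ (p ^ i)" for i
  have TO: "T i \<in> \<O>" for i using x by (simp add: T_def)
  define f where "f t = t ^ 3 - (of_int e1 * t\<^sup>2 + of_int e2 * t + of_int e3)" for t :: real
  have f: "f (T i) \<in> O_mod p" for i
  proof (induction i)
    case 0
    then show ?case using e by (simp add: T_def f_def)
  next
    case (Suc i)
    have "T (Suc i) = T i ^ p" by (simp add: T_def mult.commute flip: power_mult)
    then show ?case using O_cubic_frobenius[OF p TO] Suc unfolding f_def by simp
  qed
  define N where "N = x ^ (p ^ 6) - x"
  have NO: "N \<in> \<O>" using x by (simp add: N_def)
  \<comment> \<open>\<open>R n d\<close> reads: modulo \<open>p\<close>, \<open>d\<close> divides
    N^n. These exponents add up along products, so each Vandermonde factor can be treated
    alone.\<close>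
  define R where "R n d \<longleftrightarrow> (\<exists>w\<in>\<O>. N ^ n - w * d \<in> O_mod p)" for n d
  have R_mult: "R (n + n') (d * d')" if R: "R n d" "R n' d'" and d: "d \<in> \<O>" for n n' d d'
  proof -
    obtain w w' where w: "w \<in> \<O>" "N ^ n - w * d \<in> O_mod p" "w' \<in> \<O>" "N ^ n' - w' * d' \<in> O_mod p"
      using R unfolding R_def by blast
    have "N ^ (n + n') - (w * w') * (d * d') = (N ^ n - w * d) * N ^ n' + (w * d) * (N ^ n' - w' * d')"
      by (simp add: algebra_simps power_add)
    also have "\<dots> \<in> O_mod p"
      by (intro O_mod_add O_mod_mult_right O_mod_mult_left w O_mult O_power NO d)
    finally show ?thesis unfolding R_def using w by (intro bexI[of _ "w * w'"]) auto
  qed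
  \<comment> \<open>Modulo \<open>p\<close> this factor is the p^i-th power of T d - x, and
    \<open>N\<close> is a multiple of T d - x.\<close>
  have R: "R (p ^ i) (T (i + d) - T i)" if d: "d dvd 6" for i d
  proof -
    obtain k where k: "6 = d * k" using d ..
    obtain w where w: "w \<in> \<O>" "x ^ ((p ^ d) ^ k) - x = w * (x ^ (p ^ d) - x)"
      using O_power_diff_dvd[OF x] by blast
    have "N = w * (T d - x)"
      using w(2) unfolding N_def T_def k by (simp add: power_mult)
    then have "N ^ (p ^ i) = w ^ (p ^ i) * (T d - x) ^ p ^ i"
      by (simp only: power_mult_distrib)
    then have "N ^ (p ^ i) - w ^ (p ^ i) * (T (i + d) - T i)
      = w ^ (p ^ i) * ((T d - x) ^ p ^ i - (T d ^ p ^ i - x ^ p ^ i))"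
      by (simp add: T_def power_add algebra_simps flip: power_mult)
    also have "\<dots> \<in> O_mod p"
      by (intro O_mod_mult_left O_frobenius_diff_iter p TO x O_power w)
    finally show ?thesis unfolding R_def by (rule bexI) (intro O_power w)
  qed
  have R': "R (p ^ i) (T j - T i)" if "i \<le> j" "j - i dvd 6" for i j
    using R[OF that(2), of i] that(1) by simp
  \<comment> \<open>One summand p^i for each Vandermonde factor T j - T i, in the order of the
    product. The index differences are 1, 2 and 3, all divisors of 6.\<close>
  define m where "m = p ^ 0 + p ^ 1 + p ^ 2 + p ^ 0 + p ^ 1 + p ^ 0"
  have "R (p ^ 0) (T 1 - T 0)" "R (p ^ 1) (T 2 - T 1)" "R (p ^ 2) (T 3 - T 2)"
    "R (p ^ 0) (T 2 - T 0)" "R (p ^ 1) (T 3 - T 1)" "R (p ^ 0) (T 3 - T 0)"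
    by (intro R'; simp)+
  then have "R m ((T 1 - T 0) * (T 2 - T 1) * (T 3 - T 2) * (T 2 - T 0) * (T 3 - T 1) * (T 3 - T 0))"
    unfolding m_def by (intro R_mult O_mult O_diff TO)
  then obtain w where w: "w \<in> \<O>"
    "N ^ m - w * ((T 1 - T 0) * (T 2 - T 1) * (T 3 - T 2) * (T 2 - T 0) * (T 3 - T 1) * (T 3 - T 0)) \<in> O_mod p"
    unfolding R_def by blast
  have "w * ((T 1 - T 0) * (T 2 - T 1) * (T 3 - T 2) * (T 2 - T 0) * (T 3 - T 1) * (T 3 - T 0)) \<in> O_mod p"
    by (intro O_mod_mult_left O_mod_vandermonde[of _ _ _ _ e1 e2 e3] w TO f[unfolded f_def])
  with w(2) have "N ^ m \<in> O_mod p"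
    by (drule_tac O_mod_add) auto
  moreover have "m > 0" by (simp add: m_def)
  ultimately show ?thesis unfolding N_def by blast
qed

text \<open>Modulo \<open>p\<close> the order is an algebra of dimension 3, so nilpotents have cube
  zero. The cubic shows it directly: \<open>e3\<close> is a multiple of \<open>N\<close>, hence
  nilpotent, hence divisible by \<open>p\<close>; and the lowest remaining coefficient prime to
  \<open>p\<close>, if any, is invertible modulo \<open>p\<close> and makes \<open>N\<close> or N^2
  vanish already.\<close>

lemma O_mod_nilpotent_3:
  assumes p: "prime p" and N: "N \<in> \<O>" and nil: "N ^ m \<in> O_mod p" and m: "m > 0"
  shows "N ^ 3 \<in> O_mod p"
proof -
  obtain e1 e2 e3 where e: "N ^ 3 = of_int e1 * N\<^sup>2 + of_int e2 * N + of_int e3"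
    using N by (rule O_cubic)
  have pdvd: "int p dvd e" if "of_int e ^ n \<in> O_mod p" for e n
  proof -
    have "int p dvd e ^ n" using that O_mod_of_int[of "e ^ n"] by simp
    then show ?thesis using p by (meson prime_dvd_power prime_nat_int_transfer)
  qed
  have "of_int e3 ^ m = N ^ m * (N\<^sup>2 - of_int e1 * N - of_int e2) ^ m"
    using e by (simp add: algebra_simps power2_eq_square power3_eq_cube flip: power_mult_distrib)
  also have "\<dots> \<in> O_mod p"
    by (intro O_mod_mult_right nil O_power O_diff O_mult N O_of_int)
  finally have "int p dvd e3" by (rule pdvd)
  then have e3: "of_int e3 \<in> O_mod p" by (simp add: O_mod_of_int)
  show ?thesis
  proof (cases "int p dvd e2")
    case True
    then have e2: "of_int e2 \<in> O_mod p" by (simp add: O_mod_of_int)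
    show ?thesis
    proof (cases "int p dvd e1")
      case True
      then have "of_int e1 \<in> O_mod p" by (simp add: O_mod_of_int)
      then show ?thesis
        unfolding e by (intro O_mod_add O_mod_mult_right e3 e2 N O_power)
    next
      case False
      \<comment> \<open>Modulo \<open>p\<close> the cubic reads N^3 = e1 N^2, so factors
        \<open>e1\<close> can be traded for factors \<open>N\<close> until nilpotency
        applies.\<close>
      have *: "of_int e1 ^ k * N\<^sup>2 - N ^ (k + 2) \<in> O_mod p" for k
      proof (induction k)
        case (Suc k)
        have "of_int e1 ^ Suc k * N\<^sup>2 - N ^ (Suc k + 2)
          = of_int e1 * (of_int e1 ^ k * N\<^sup>2 - N ^ (k + 2)) + N ^ k * (of_int e1 * N\<^sup>2 - N ^ 3)"
          by (simp add: algebra_simps power2_eq_square power3_eq_cube)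
        also have "of_int e1 * N\<^sup>2 - N ^ 3 = - (of_int e2 * N) - of_int e3"
          by (simp add: e)
        also have "of_int e1 * (of_int e1 ^ k * N\<^sup>2 - N ^ (k + 2)) + N ^ k * \<dots> \<in> O_mod p"
          by (intro O_mod_add O_mod_mult_left[OF Suc] O_mod_mult_left O_mod_diff O_mod_uminus
              O_mod_mult_right e2 e3 N O_power O_of_int)
        finally show ?case .
      qed (simp add: power2_eq_square)
      have "N ^ (m + 2) \<in> O_mod p"
        unfolding power_add by (intro O_mod_mult_right nil O_power N)
      from O_mod_add[OF *[of m] this] have *: "of_int (e1 ^ m) * N\<^sup>2 \<in> O_mod p" by simp
      have "\<not> int p dvd e1 ^ m"
        using False p by (meson prime_dvd_power prime_nat_int_transfer)
      from O_mod_cancel[OF p this * O_power[OF N]] have "N\<^sup>2 \<in> O_mod p" .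
      then have "N\<^sup>2 * N \<in> O_mod p" by (intro O_mod_mult_right N)
      then show ?thesis by (simp add: power2_eq_square power3_eq_cube)
    qed
  next
    case False
    define v where "v = N\<^sup>2 - of_int e1 * N"
    \<comment> \<open>Modulo \<open>p\<close> the cubic reads N v = e2 N, and \<open>v\<close> is a
      multiple of \<open>N\<close>, hence nilpotent too.\<close>
    have v: "v \<in> \<O>" using N by (simp add: v_def)
    have *: "of_int e2 ^ k * N - N * v ^ k \<in> O_mod p" for k
    proof (induction k)
      case (Suc k)
      have "of_int e2 ^ Suc k * N - N * v ^ Suc k
        = of_int e2 * (of_int e2 ^ k * N - N * v ^ k) + v ^ k * (of_int e2 * N - N * v)"
        by (simp add: algebra_simps)
      also have "of_int e2 * N - N * v = - of_int e3"
        using e by (simp add: v_def algebra_simps power2_eq_square power3_eq_cube)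
      also have "of_int e2 * (of_int e2 ^ k * N - N * v ^ k) + v ^ k * \<dots> \<in> O_mod p"
        by (intro O_mod_add O_mod_mult_left[OF Suc] O_mod_mult_left O_mod_uminus e3 v O_power O_of_int)
      finally show ?case .
    qed simp
    have "v = N * (N - of_int e1)" by (simp add: v_def algebra_simps power2_eq_square)
    then have "v ^ m = N ^ m * (N - of_int e1) ^ m"
      by (simp only: power_mult_distrib)
    then have "N * v ^ m = N ^ m * (N * (N - of_int e1) ^ m)"
      by simp
    also have "\<dots> \<in> O_mod p"
      by (intro O_mod_mult_right nil O_power O_diff O_mult N O_of_int)
    finally have "N * v ^ m \<in> O_mod p" .
    from O_mod_add[OF *[of m] this] have *: "of_int (e2 ^ m) * N \<in> O_mod p" by simp
    have "\<not> int p dvd e2 ^ m"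
      using False p by (meson prime_dvd_power prime_nat_int_transfer)
    from O_mod_cancel[OF p this * N] have "N \<in> O_mod p" .
    then show ?thesis by (rule O_mod_power) simp
  qed
qed

section \<open>Unit exponents modulo prime powers and modulo D\<close>

lemma O_mod_lift:
  assumes "x \<in> \<O>" "x - 1 \<in> O_mod (p ^ j)" "j > 0"
  shows "x ^ p - 1 \<in> O_mod (p ^ Suc j)"
proof -
  obtain t where t: "t \<in> \<O>" "x - 1 = real (p ^ j) * t"
    using assms(2) by (auto simp: O_mod_def)
  then have "x - 1 = real p * (real (p ^ (j - 1)) * t)"
    using assms(3) by (cases j) auto
  then have x1: "x - 1 \<in> O_mod p"
    using t by (metis O_modI O_mult O_of_nat)
  \<comment> \<open>The geometric sum has p terms, each congruent to 1, so it supplies the extra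
    factor p.\<close>
  have "(\<Sum>i<p. x ^ i) - of_nat p * 1 = (\<Sum>i<p. x ^ i - 1 ^ i)"
    by (simp add: sum_subtractf)
  also have "\<dots> \<in> O_mod p"
    by (intro O_mod_sum O_mod_power_diff x1 assms O_1)
  finally have "((\<Sum>i<p. x ^ i) - of_nat p * 1) + real p * 1 \<in> O_mod p"
    by (intro O_mod_add O_modI) auto
  then obtain s where s: "s \<in> \<O>" "(\<Sum>i<p. x ^ i) = real p * s"
    by (auto simp: O_mod_def)
  have "x ^ p - 1 = (x - 1) * (\<Sum>i<p. x ^ i)"
    by (rule power_diff_1_eq)
  also have "\<dots> = real (p ^ Suc j) * (t * s)"
    unfolding s t by simp
  also have "\<dots> \<in> O_mod (p ^ Suc j)"
    by (intro O_modI O_mult s t)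
  finally show ?thesis .
qed

text \<open>The p^e-th power is additive modulo \<open>p\<close> and kills the nilpotent u^(p^6) - u
  once p^e \<ge> 3; dividing by u^(p^e) then leaves a power of \<open>u\<close> congruent to
  1.\<close>

lemma O_unit_power_prime:
  assumes p: "prime p" and u: "u \<in> \<O>" "v \<in> \<O>" "u * v = 1"
  shows "u ^ (2 * p * (p ^ 6 - 1)) - 1 \<in> O_mod p"
proof -
  define N where "N = u ^ (p ^ 6) - u"
  have NO: "N \<in> \<O>" using u by (simp add: N_def)
  have N3: "N ^ 3 \<in> O_mod p"
    using O_frobenius_6_nilpotent[OF p u(1)] O_mod_nilpotent_3[OF p NO] unfolding N_def by blast
  \<comment> \<open>A power of p not below the nilpotency index 3: p itself, except that p = 2 needs
    4 = 2 p. This is the origin of the factor 2 in the exponent.\<close>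
  obtain e where e: "p ^ e dvd 2 * p" "p ^ e \<ge> 3"
  proof (cases "p = 2")
    case True
    show ?thesis by (rule that[of 2]) (auto simp: True)
  next
    case False
    then have "p \<ge> 3" using prime_ge_2_nat[OF p] by simp
    then show ?thesis by (intro that[of 1]) auto
  qed
  have "N ^ (p ^ e) = N ^ 3 * N ^ (p ^ e - 3)"
    using e by (simp flip: power_add)
  also have "\<dots> \<in> O_mod p"
    by (intro O_mod_mult_right N3 O_power NO)
  finally have 1: "N ^ (p ^ e) \<in> O_mod p" .
  have "(u ^ (p ^ 6)) ^ (p ^ e) - u ^ (p ^ e) = N ^ (p ^ e) - (N ^ (p ^ e) - ((u ^ (p ^ 6)) ^ (p ^ e) - u ^ (p ^ e)))"
    by simp
  also have "\<dots> \<in> O_mod p"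
    unfolding N_def by (intro O_mod_diff 1[unfolded N_def] O_frobenius_diff_iter p u O_power)
  finally have 2: "((u ^ (p ^ 6)) ^ (p ^ e) - u ^ (p ^ e)) * v ^ (p ^ e) \<in> O_mod p"
    by (rule O_mod_mult_right) (use u in auto)
  have "u ^ (p ^ 6) * v = u ^ (p ^ 6 - 1) * (u * v)"
    using prime_gt_0_nat[OF p] by (simp add: power_eq_if)
  then have "((u ^ (p ^ 6)) ^ (p ^ e) - u ^ (p ^ e)) * v ^ (p ^ e) = (u ^ (p ^ 6 - 1)) ^ (p ^ e) - 1"
    using u(3) by (simp add: left_diff_distrib flip: power_mult_distrib)
  with 2 have 3: "(u ^ (p ^ 6 - 1)) ^ (p ^ e) - 1 \<in> O_mod p" by simp
  obtain k where k: "2 * p = p ^ e * k" using e by (auto elim: dvdE)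
  have "((u ^ (p ^ 6 - 1)) ^ (p ^ e)) ^ k - 1 ^ k \<in> O_mod p"
    by (rule O_mod_power_diff[OF 3]) (use u in auto)
  moreover have "2 * p * (p ^ 6 - 1) = (p ^ 6 - 1) * p ^ e * k"
    by (simp add: k)
  ultimately show ?thesis
    by (simp only: power_mult power_one)
qed

lemma O_unit_power_prime_power:
  assumes p: "prime p" and u: "u \<in> \<O>" "v \<in> \<O>" "u * v = 1"
  shows "u ^ (2 * p ^ Suc j * (p ^ 6 - 1)) - 1 \<in> O_mod (p ^ Suc j)"
proof (induction j)
  case 0
  then show ?case using O_unit_power_prime[OF assms] by simp
next
  case (Suc j)
  have "(u ^ (2 * p ^ Suc j * (p ^ 6 - 1))) ^ p - 1 \<in> O_mod (p ^ Suc (Suc j))"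
    by (rule O_mod_lift[OF _ Suc]) (use u in auto)
  then show ?case
    by (simp add: algebra_simps flip: power_mult)
qed

end

text \<open>A natural number, because it serves as an exponent; the truncated subtraction is
  harmless since p^6 \<ge> 1 for primes p.\<close>

definition psi_nat :: "nat \<Rightarrow> nat"
  where "psi_nat D = D * (\<Prod>p \<in> {p. prime p \<and> p dvd D}. (p ^ 6 - 1))"

lemma psi_eq: "psi D = real (psi_nat D)"
proof -
  have "real (p ^ 6 - 1) = real p ^ 6 - 1" if "prime p" for p
    using prime_gt_0_nat[OF that] by (simp add: of_nat_diff Suc_le_eq)
  then show ?thesis
    unfolding psi_def psi_nat_def by (simp add: of_nat_prod)
qed

lemma psi_nat_pos:
  assumes "D > 0"
  shows "psi_nat D > 0"
proof -
  have "p ^ 6 - 1 > 0" if "prime p" for p :: nat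
    using one_less_power[of p 6] prime_gt_1_nat[OF that] by simp
  then show ?thesis
    unfolding psi_nat_def using assms by (auto intro!: prod_pos)
qed

context integral_cubic begin

text \<open>If p^k divides D exactly, the exponent 2 p^k (p^6 - 1) that works modulo p^k divides 2
  psi(D).\<close>

lemma O_unit_power_psi:
  assumes D: "D > 0" and u: "u \<in> \<O>" "v \<in> \<O>" "u * v = 1"
  shows "u ^ (2 * psi_nat D) - 1 \<in> O_mod D"
proof (rule O_mod_prime_powers[OF D])
  fix p assume p: "prime p" "p dvd D"
  define j where "j = multiplicity p D - 1"
  have j: "multiplicity p D = Suc j"
    using p D by (simp add: j_def prime_multiplicity_gt_zero_iff)
  have "p ^ Suc j dvd D" unfolding j[symmetric] by (rule multiplicity_dvd)
  moreover have "p ^ 6 - 1 dvd (\<Prod>p \<in> {p. prime p \<and> p dvd D}. (p ^ 6 - 1))"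
    using p D by (intro dvd_prodI) (auto intro: finite_subset[OF _ finite_divisors_nat])
  ultimately have "p ^ Suc j * (p ^ 6 - 1) dvd psi_nat D"
    unfolding psi_nat_def by (rule mult_dvd_mono)
  then obtain k where k: "psi_nat D = p ^ Suc j * (p ^ 6 - 1) * k" ..
  have "(u ^ (2 * p ^ Suc j * (p ^ 6 - 1))) ^ k - 1 ^ k \<in> O_mod (p ^ Suc j)"
    by (rule O_mod_power_diff[OF O_unit_power_prime_power[OF p(1) u]]) (use u in auto)
  then show "u ^ (2 * psi_nat D) - 1 \<in> O_mod (p ^ multiplicity p D)"
    by (simp add: k j mult.assoc flip: power_mult)
qed (use u in auto)

end

section \<open>Existence of units\<close>

text \<open>One notion for maps on the order and on the field. The trivial kernel is demanded
  explicitly because \<open>S\<close> need not be a field.\<close>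

definition inj_ring_hom_on :: "real set \<Rightarrow> (real \<Rightarrow> 'a :: field) \<Rightarrow> bool"
  where "inj_ring_hom_on S t \<longleftrightarrow> t 1 = 1 \<and> (\<forall>x\<in>S. t x = 0 \<longrightarrow> x = 0) \<and>
    (\<forall>x\<in>S. \<forall>y\<in>S. t (x + y) = t x + t y \<and> t (x * y) = t x * t y)"

lemma inj_ring_hom_on_subset: "inj_ring_hom_on S t \<Longrightarrow> S' \<subseteq> S \<Longrightarrow> inj_ring_hom_on S' t"
  unfolding inj_ring_hom_on_def by blast

context integral_cubic begin

context
  fixes t :: "real \<Rightarrow> complex"
  assumes t: "inj_ring_hom_on \<O> t"
begin

lemma hom_1: "t 1 = 1"
  and hom_add: "x \<in> \<O> \<Longrightarrow> y \<in> \<O> \<Longrightarrow> t (x + y) = t x + t y"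
  and hom_mult: "x \<in> \<O> \<Longrightarrow> y \<in> \<O> \<Longrightarrow> t (x * y) = t x * t y"
  and hom_inj: "x \<in> \<O> \<Longrightarrow> t x = 0 \<Longrightarrow> x = 0"
  using t by (auto simp: inj_ring_hom_on_def)

lemma hom_0: "t 0 = 0"
  using hom_add[of 0 0] by simp

lemma hom_uminus: "x \<in> \<O> \<Longrightarrow> t (- x) = - t x"
  using hom_add[of x "- x"] hom_0 by (simp add: eq_neg_iff_add_eq_0 add.commute)

lemma hom_diff: "x \<in> \<O> \<Longrightarrow> y \<in> \<O> \<Longrightarrow> t (x - y) = t x - t y"
  using hom_add[of x "- y"] hom_uminus[of y] by simp

lemma hom_power: "x \<in> \<O> \<Longrightarrow> t (x ^ n) = t x ^ n"
  by (induction n) (auto simp: hom_1 hom_mult)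

lemma hom_of_nat: "t (of_nat n) = of_nat n"
  by (induction n) (auto simp: hom_0 hom_1 hom_add)

lemma hom_of_int: "t (of_int n) = of_int n"
  using hom_of_nat[of "nat n"] hom_of_nat[of "nat (- n)"] hom_uminus[of "of_nat (nat (- n))"]
  by (cases "n \<ge> 0") auto

lemma hom_coords:
  "t (of_int x + of_int y * \<gamma> + of_int z * \<gamma>\<^sup>2) = of_int x + of_int y * t \<gamma> + of_int z * (t \<gamma>)\<^sup>2"
  by (simp add: hom_add hom_mult hom_of_int hom_power)

end

end

text \<open>By \<open>roots\<close>, t0, t1, t2 produce all three roots of the cubic of \<gamma>, so
  norms are products of the three values. The places enter symmetrically, which allows
  reinterpretation with another one in front.\<close>

locale cubic_places = integral_cubic +
  fixes t0 t1 t2 :: "real \<Rightarrow> complex"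
  assumes hom0: "inj_ring_hom_on \<O> t0" and hom1: "inj_ring_hom_on \<O> t1" and hom2: "inj_ring_hom_on \<O> t2"
    and roots: "t0 \<gamma> + t1 \<gamma> + t2 \<gamma> = of_int a"
      "t0 \<gamma> * t1 \<gamma> + t0 \<gamma> * t2 \<gamma> + t1 \<gamma> * t2 \<gamma> = - of_int b"
      "t0 \<gamma> * t1 \<gamma> * t2 \<gamma> = of_int c"
begin

text \<open>The cofactor \<open>y\<close> is the product of the other two conjugates; written as x^2
  - e1 x + e2 it visibly lies in the order. The identity is checked under t0 and pulled back by
  injectivity.\<close>

lemma norm_int:
  assumes x: "x \<in> \<O>" "x \<noteq> 0"
  obtains n y where "n \<noteq> 0" "t0 x * t1 x * t2 x = of_int n" "y \<in> \<O>" "x * y = of_int n"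
proof -
  obtain p q r where x_eq: "x = of_int p + of_int q * \<gamma> + of_int r * \<gamma>\<^sup>2"
    using x(1) by (rule cubic_orderE)
  note hom = hom_coords[OF hom0] hom_coords[OF hom1] hom_coords[OF hom2]
  obtain e1 e2 n :: int where e: "t0 x + t1 x + t2 x = of_int e1"
      "t0 x * t1 x + t0 x * t2 x + t1 x * t2 x = of_int e2" "t0 x * t1 x * t2 x = of_int n"
    using charpoly[OF roots, of p q r] unfolding x_eq hom by blast
  define y where "y = x\<^sup>2 - of_int e1 * x + of_int e2"
  have y: "y \<in> \<O>" using x by (simp add: y_def)
  have "t0 (x * y - of_int n) = t0 x * ((t0 x)\<^sup>2 - of_int e1 * t0 x + of_int e2) - of_int n"
    using x y unfolding y_def
    by (simp add: hom_diff[OF hom0] hom_add[OF hom0] hom_mult[OF hom0] hom_power[OF hom0] hom_of_int[OF hom0])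
  also have "\<dots> = 0"
    unfolding e[symmetric] by (simp add: algebra_simps power2_eq_square)
  finally have "x * y = of_int n"
    using hom_inj[OF hom0, of "x * y - of_int n"] x y by simp
  moreover have "n \<noteq> 0"
  proof
    assume "n = 0"
    then have "t0 x = 0 \<or> t1 x = 0 \<or> t2 x = 0" using e(3) by simp
    then show False
      using x hom_inj[OF hom0] hom_inj[OF hom1] hom_inj[OF hom2] by blast
  qed
  ultimately show ?thesis using that e(3) y by blast
qed

lemma norm_unit:
  assumes "u \<in> \<O>" "v \<in> \<O>" "u * v = 1"
  shows "cmod (t0 u) * cmod (t1 u) * cmod (t2 u) = 1"
proof -
  have uv: "u \<noteq> 0" "v \<noteq> 0" using assms by auto
  obtain n y where n: "n \<noteq> 0" "t0 u * t1 u * t2 u = of_int n"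
    using norm_int[OF assms(1) uv(1)] by metis
  obtain m y where m: "m \<noteq> 0" "t0 v * t1 v * t2 v = of_int m"
    using norm_int[OF assms(2) uv(2)] by metis
  have "(t0 u * t1 u * t2 u) * (t0 v * t1 v * t2 v) = t0 (u * v) * t1 (u * v) * t2 (u * v)"
    unfolding hom_mult[OF hom0 assms(1,2)] hom_mult[OF hom1 assms(1,2)] hom_mult[OF hom2 assms(1,2)]
    by (simp only: ac_simps)
  also have "\<dots> = 1" using assms hom_1[OF hom0] hom_1[OF hom1] hom_1[OF hom2] by simp
  finally have "(of_int (n * m) :: complex) = of_int 1" unfolding n m by simp
  then have "n * m = 1" by (simp only: of_int_eq_iff)
  then have "\<bar>n\<bar> = 1" by (auto simp: zmult_eq_1_iff)
  have "cmod (t0 u) * cmod (t1 u) * cmod (t2 u) = cmod (of_int n)"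
    unfolding n(2)[symmetric] by (simp add: norm_mult)
  also have "\<dots> = 1" using \<open>\<bar>n\<bar> = 1\<close> by (metis norm_of_int of_int_1 of_int_abs)
  finally show ?thesis .
qed

text \<open>Box principle for the linear form p + q \<theta> + r \<theta>^2. The exponents are
  balanced so that the norms stay below K^2, whatever N is.\<close>

lemma small_elements:
  assumes t0: "t0 \<gamma> = of_real \<theta>"
  obtains K where "K \<ge> 1" "\<And>N. N > 0 \<Longrightarrow> \<exists>x\<in>\<O>. x \<noteq> 0 \<and> cmod (t0 x) \<le> 1 / (real N)\<^sup>2
    \<and> cmod (t1 x) \<le> K * real N \<and> cmod (t2 x) \<le> K * real N"
proof -
  define B where "B = 1 + \<bar>\<theta>\<bar> + \<theta>\<^sup>2"
  define K where "K = B + cmod (t1 \<gamma>) + (cmod (t1 \<gamma>))\<^sup>2 + cmod (t2 \<gamma>) + (cmod (t2 \<gamma>))\<^sup>2"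
  have B: "B \<ge> 1" by (simp add: B_def)
  have K: "K \<ge> 1" using B by (simp add: K_def add_increasing2)
  moreover have "\<exists>x\<in>\<O>. x \<noteq> 0 \<and> cmod (t0 x) \<le> 1 / (real N)\<^sup>2
    \<and> cmod (t1 x) \<le> K * real N \<and> cmod (t2 x) \<le> K * real N" if N: "N > 0" for N
  proof -
    define g where "g = (\<lambda>(y, z). real y * \<theta> + real z * \<theta>\<^sup>2)"
    \<comment> \<open>The box of length 1/N^2 that contains the fractional part: N^2 boxes for (N +
      1)^2 pairs.\<close>
    define h where "h p = nat \<lfloor>frac (g p) * (real N)\<^sup>2\<rfloor>" for p
    have h: "h p < N\<^sup>2" for p
    proof -
      have "frac (g p) * (real N)\<^sup>2 < 1 * (real N)\<^sup>2"
        using N frac_lt_1[of "g p"] by (intro mult_strict_right_mono) auto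
      then have "\<lfloor>frac (g p) * (real N)\<^sup>2\<rfloor> < int (N\<^sup>2)" by (simp add: floor_less_iff)
      then show ?thesis using N by (simp add: h_def nat_less_iff)
    qed
    have "card (h ` ({..N} \<times> {..N})) \<le> card {..<N\<^sup>2}"
      using h by (intro card_mono) auto
    also have "\<dots> < card ({..N} \<times> {..N})"
      by (simp add: card_cartesian_product power2_eq_square)
    finally have "\<not> inj_on h ({..N} \<times> {..N})" by (rule pigeonhole)
    then obtain y z y' z' where yz: "y \<le> N" "z \<le> N" "y' \<le> N" "z' \<le> N" "(y, z) \<noteq> (y', z')" "h (y, z) = h (y', z')"
      by (auto simp: inj_on_def)
    \<comment> \<open>With this \<open>p\<close> the value of the form is the difference of two
      fractional parts in one box.\<close>
    define p q r where "p = \<lfloor>g (y', z')\<rfloor> - \<lfloor>g (y, z)\<rfloor>" and "q = int y - int y'" and "r = int z - int z'"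
    define x where "x = of_int p + of_int q * \<gamma> + of_int r * \<gamma>\<^sup>2"
    have x0: "x \<noteq> 0"
      using indep[of p q r] yz(5) unfolding x_def q_def r_def by auto
    have qr: "\<bar>of_int q\<bar> \<le> real N" "\<bar>of_int r\<bar> \<le> real N" using yz by (auto simp: q_def r_def)
    define s where "s = of_int p + of_int q * \<theta> + of_int r * \<theta>\<^sup>2"
    have s: "s = frac (g (y, z)) - frac (g (y', z'))"
      by (simp add: s_def p_def q_def r_def frac_def g_def algebra_simps)
    define f where "f = frac (g (y, z)) * (real N)\<^sup>2"
    define f' where "f' = frac (g (y', z')) * (real N)\<^sup>2"
    have "f \<ge> 0" "f' \<ge> 0" by (auto simp: f_def f'_def)
    then have "\<lfloor>f\<rfloor> = \<lfloor>f'\<rfloor>" using yz(6) unfolding h_def f_def[symmetric] f'_def[symmetric]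
      by (simp add: eq_nat_nat_iff)
    then have "\<bar>f - f'\<bar> < 1" by linarith
    then have "\<bar>s\<bar> * (real N)\<^sup>2 < 1"
      unfolding s f_def f'_def by (simp add: abs_mult flip: left_diff_distrib)
    then have s1: "\<bar>s\<bar> \<le> 1 / (real N)\<^sup>2"
      using N by (simp add: field_simps)
    have "1 / (real N)\<^sup>2 \<le> 1" using N by simp
    also have "1 \<le> real N" using N by simp
    finally have s2: "\<bar>s\<bar> \<le> real N" using s1 by linarith
    have "of_int p = s - of_int q * \<theta> - of_int r * \<theta>\<^sup>2" by (simp add: s_def)
    then have "\<bar>of_int p\<bar> \<le> \<bar>s\<bar> + \<bar>of_int q * \<theta>\<bar> + \<bar>of_int r * \<theta>\<^sup>2\<bar>" by linarith
    also have "\<dots> = \<bar>s\<bar> + \<bar>of_int q\<bar> * \<bar>\<theta>\<bar> + \<bar>of_int r\<bar> * \<theta>\<^sup>2" by (simp add: abs_mult)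
    also have "\<dots> \<le> real N + real N * \<bar>\<theta>\<bar> + real N * \<theta>\<^sup>2"
      by (intro add_mono mult_right_mono s2 qr) auto
    finally have p: "\<bar>of_int p\<bar> \<le> real N * B" by (simp add: B_def algebra_simps)
    have bound: "cmod (t x) \<le> (B + cmod (t \<gamma>) + (cmod (t \<gamma>))\<^sup>2) * real N" if t: "inj_ring_hom_on \<O> t" for t
    proof -
      have "cmod (t x) \<le> cmod (of_int p) + cmod (of_int q * t \<gamma>) + cmod (of_int r * (t \<gamma>)\<^sup>2)"
        unfolding x_def hom_coords[OF t] by (meson add_mono norm_triangle_ineq order_refl order_trans)
      also have "\<dots> = \<bar>of_int p\<bar> + \<bar>of_int q\<bar> * cmod (t \<gamma>) + \<bar>of_int r\<bar> * (cmod (t \<gamma>))\<^sup>2"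
        by (simp add: norm_mult norm_power)
      also have "\<dots> \<le> real N * B + real N * cmod (t \<gamma>) + real N * (cmod (t \<gamma>))\<^sup>2"
        by (intro add_mono mult_right_mono p qr) auto
      finally show ?thesis by (simp add: algebra_simps)
    qed
    have "t0 x = of_real s"
      unfolding x_def hom_coords[OF hom0] t0 s_def by simp
    then have "cmod (t0 x) \<le> 1 / (real N)\<^sup>2" using s1 by simp
    moreover have "cmod (t1 x) \<le> K * real N"
      by (rule order_trans[OF bound[OF hom1]]) (auto simp: K_def intro!: mult_right_mono)
    moreover have "cmod (t2 x) \<le> K * real N"
      by (rule order_trans[OF bound[OF hom2]]) (auto simp: K_def intro!: mult_right_mono)
    moreover have "x \<in> \<O>" unfolding x_def by (rule cubic_orderI)
    ultimately show ?thesis using x0 by blast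
  qed
  ultimately show ?thesis using that by blast
qed

text \<open>Among infinitely many elements of bounded norm, two have the same norm n and are
  congruent modulo n; their quotient is a unit. The sizes are spaced geometrically so that this
  quotient is large at both t1 and t2.\<close>

lemma ex_unit:
  assumes t0: "t0 \<gamma> = of_real \<theta>"
  shows "\<exists>u\<in>\<O>. \<exists>v\<in>\<O>. u * v = 1 \<and> cmod (t1 u) > 1 \<and> cmod (t2 u) > 1"
proof -
  obtain K where K: "K \<ge> 1" and small: "\<And>N. N > 0 \<Longrightarrow> \<exists>x\<in>\<O>. x \<noteq> 0 \<and> cmod (t0 x) \<le> 1 / (real N)\<^sup>2
    \<and> cmod (t1 x) \<le> K * real N \<and> cmod (t2 x) \<le> K * real N"
    using small_elements[OF t0] by metis
  \<comment> \<open>At t1 and t2 the k-th element has size between c^k / K and K c^k, so for i < j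
    the quotient is at least c^(j - i) / K^2. Hence the requirement c > K^2.\<close>
  define c where "c = nat \<lceil>K\<^sup>2\<rceil> + 1"
  have c: "real c > K\<^sup>2"
    unfolding c_def of_nat_add using real_nat_ceiling_ge[of "K\<^sup>2"] by linarith
  have c1: "real c \<ge> 1" unfolding c_def of_nat_add using of_nat_0_le_iff[of "nat \<lceil>K\<^sup>2\<rceil>"] by linarith
  then have "\<exists>x. x \<in> \<O> \<and> x \<noteq> 0 \<and> cmod (t0 x) \<le> 1 / (real (c ^ k))\<^sup>2
    \<and> cmod (t1 x) \<le> K * real (c ^ k) \<and> cmod (t2 x) \<le> K * real (c ^ k)" for k
    using small[of "c ^ k"] by force
  then obtain \<xi> where xi: "\<And>k. \<xi> k \<in> \<O>" "\<And>k. \<xi> k \<noteq> 0" "\<And>k. cmod (t0 (\<xi> k)) \<le> 1 / (real (c ^ k))\<^sup>2"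
    "\<And>k. cmod (t1 (\<xi> k)) \<le> K * real (c ^ k)" "\<And>k. cmod (t2 (\<xi> k)) \<le> K * real (c ^ k)"
    by metis
  have "\<exists>n y. n \<noteq> 0 \<and> t0 (\<xi> k) * t1 (\<xi> k) * t2 (\<xi> k) = of_int n \<and> y \<in> \<O> \<and> \<xi> k * y = of_int n" for k
    using norm_int[OF xi(1,2)[of k]] by metis
  then obtain n y where n: "\<And>k. n k \<noteq> 0" "\<And>k. t0 (\<xi> k) * t1 (\<xi> k) * t2 (\<xi> k) = of_int (n k)"
    and y: "\<And>k. y k \<in> \<O>" "\<And>k. \<xi> k * y k = of_int (n k)"
    by metis
  have "\<exists>q r s. \<xi> k = of_int q + of_int r * \<gamma> + of_int s * \<gamma>\<^sup>2" for k
    using xi(1)[of k] by (auto simp: cubic_order_def)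
  then obtain q r s where qrs: "\<And>k. \<xi> k = of_int (q k) + of_int (r k) * \<gamma> + of_int (s k) * \<gamma>\<^sup>2"
    by metis
  have norm_le: "cmod (t0 (\<xi> k)) * cmod (t1 (\<xi> k)) * cmod (t2 (\<xi> k)) = \<bar>of_int (n k)\<bar>" for k
    using arg_cong[OF n(2)[of k], of cmod] by (simp add: norm_mult)
  have n_le: "\<bar>of_int (n k)\<bar> \<le> K\<^sup>2" for k
  proof -
    have "cmod (t0 (\<xi> k)) * cmod (t1 (\<xi> k)) * cmod (t2 (\<xi> k))
      \<le> 1 / (real (c ^ k))\<^sup>2 * (K * real (c ^ k)) * (K * real (c ^ k))"
      using K c1 by (intro mult_mono xi) auto
    also have "\<dots> = K\<^sup>2" using c1 by (simp add: power2_eq_square)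
    finally show ?thesis unfolding norm_le .
  qed
  define M where "M = \<lfloor>K\<^sup>2\<rfloor>"
  have n_le': "\<bar>n k\<bar> \<le> M" for k
    unfolding M_def using n_le[of k] by (simp add: le_floor_iff)
  \<comment> \<open>The norm together with the coordinates modulo the norm; bounded norms leave
    finitely many values.\<close>
  define f where "f k = (n k, q k mod n k, r k mod n k, s k mod n k)" for k
  have mod_le: "z mod n k \<in> {-M..M}" for z k
    using abs_mod_less[of "n k" z] n(1)[of k] n_le'[of k] by auto
  have "range f \<subseteq> {-M..M} \<times> {-M..M} \<times> {-M..M} \<times> {-M..M}"
    using mod_le n_le' by (auto simp: f_def abs_le_iff minus_le_iff)
  then have "finite (range f)" by (rule finite_subset) auto
  then have "\<not> inj f" using range_inj_infinite by blast
  then obtain i j where "f i = f j" "i \<noteq> j" by (auto simp: inj_def)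
  then obtain i j where ij: "f i = f j" "i < j" by (metis linorder_neqE_nat)
  define m where "m = nat \<bar>n i\<bar>"
  have nn: "n j = n i" and dvd: "n i dvd q j - q i" "n i dvd r j - r i" "n i dvd s j - s i"
    using ij(1) unfolding f_def by (auto simp: mod_eq_dvd_iff dvd_diff_commute)
  have "\<xi> j - \<xi> i = of_int (q j - q i) + of_int (r j - r i) * \<gamma> + of_int (s j - s i) * \<gamma>\<^sup>2"
    unfolding qrs by (simp add: algebra_simps)
  also have "\<dots> \<in> O_mod m"
    unfolding O_mod_coords m_def using dvd by simp
  finally obtain w where w: "w \<in> \<O>" "\<xi> j - \<xi> i = real m * w"
    unfolding O_mod_def by blast
  define e where "e = sgn (n i)"
  have e: "of_int e * of_int (n i) = real m"
    unfolding m_def e_def of_int_mult[symmetric] by (simp add: sgn_mult_self_eq mult.commute abs_sgn[symmetric])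
  \<comment> \<open>\<xi> j = \<xi> i + m w and m = e n i = e \<xi> i y i, so \<open>u\<close> is
    the quotient \<xi> j / \<xi> i; \<open>v\<close> is its inverse by the same computation, since
    the norms agree.\<close>
  define u v where "u = 1 + of_int e * w * y i" and "v = 1 - of_int e * w * y j"
  have uv: "u \<in> \<O>" "v \<in> \<O>" using w y by (auto simp: u_def v_def)
  have "\<xi> i * u = \<xi> i + (of_int e * (\<xi> i * y i)) * w" by (simp add: u_def algebra_simps)
  then have Xu: "\<xi> i * u = \<xi> j" unfolding y e using w(2) by simp
  have "\<xi> j * v = \<xi> j - (of_int e * (\<xi> j * y j)) * w" by (simp add: v_def algebra_simps)
  then have Xv: "\<xi> j * v = \<xi> i" unfolding y nn e using w(2) by simp
  have "\<xi> i * (u * v) = \<xi> i * 1" using Xu Xv by (simp flip: mult.assoc)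
  then have "u * v = 1" using xi(2)[of i] by simp
  moreover have big: "cmod (t u) > 1"
    if t: "inj_ring_hom_on \<O> t" and up: "\<And>k. cmod (t (\<xi> k)) \<le> K * real (c ^ k)"
      and lo: "\<And>k. cmod (t (\<xi> k)) * K \<ge> real (c ^ k)" for t
  proof -
    have ci: "real (c ^ i) > 0" using c1 by simp
    have "real (c ^ i) * real c \<le> real (c ^ i) * real (c ^ (j - i))"
      using c1 ij(2) by (intro mult_left_mono) (auto intro: self_le_power)
    also have "\<dots> = real (c ^ j)"
      using ij(2) by (simp flip: power_add)
    also have "\<dots> \<le> cmod (t (\<xi> j)) * K" by (rule lo)
    also have "\<dots> = cmod (t (\<xi> i)) * cmod (t u) * K"
      unfolding Xu[symmetric] hom_mult[OF t xi(1) uv(1)] by (simp add: norm_mult)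
    also have "\<dots> \<le> (K * real (c ^ i)) * cmod (t u) * K"
      using K by (intro mult_right_mono up) auto
    also have "\<dots> = real (c ^ i) * (K\<^sup>2 * cmod (t u))" by (simp add: power2_eq_square)
    finally have "real c \<le> K\<^sup>2 * cmod (t u)"
      using ci by (simp only: mult_le_cancel_left_pos)
    with c have "K\<^sup>2 * 1 < K\<^sup>2 * cmod (t u)" by linarith
    then show ?thesis using K by (simp only: mult_less_cancel_left_pos zero_less_power)
  qed
  \<comment> \<open>The norm is at least 1 in absolute value, so upper bounds at two places give a
    lower bound at the third.\<close>
  have lo: "real (c ^ k) \<le> A * K" if "cmod (t0 (\<xi> k)) * A * A' \<ge> 1" "A' \<le> K * real (c ^ k)" "A \<ge> 0" for k A A'
  proof -
    have ck: "real (c ^ k) > 0" using c1 by simp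
    have "1 \<le> cmod (t0 (\<xi> k)) * A * A'" by (rule that)
    also have "\<dots> \<le> (1 / (real (c ^ k))\<^sup>2 * A) * (K * real (c ^ k))"
      using that(3) xi(3)[of k] K
      by (intro order_trans[OF mult_left_mono[OF that(2)]] mult_right_mono) auto
    also have "\<dots> = A * K / real (c ^ k)" using ck by (simp add: power2_eq_square)
    finally show ?thesis using ck by (simp add: field_simps)
  qed
  have ge1: "cmod (t0 (\<xi> k)) * cmod (t1 (\<xi> k)) * cmod (t2 (\<xi> k)) \<ge> 1" for k
    unfolding norm_le using n(1)[of k] by (metis of_int_1_le_iff of_int_abs zero_less_abs_iff int_one_le_iff_zero_less)
  have "cmod (t1 u) > 1"
    by (rule big[OF hom1 xi(4)]) (rule lo[OF ge1 xi(5)], simp)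
  moreover have "cmod (t2 u) > 1"
  proof (rule big[OF hom2 xi(5)], rule lo[OF _ xi(4)])
    show "1 \<le> cmod (t0 (\<xi> k)) * cmod (t2 (\<xi> k)) * cmod (t1 (\<xi> k))" for k
      using ge1[of k] by (simp add: ac_simps)
  qed simp
  ultimately show ?thesis using uv by blast
qed

end

section \<open>Units with nearly equal conjugates\<close>

lemma powr_minus_half_squared:
  fixes x :: real
  assumes "x > 0"
  shows "(x powr (- 1 / 2))\<^sup>2 = 1 / x"
proof -
  have "(x powr (- 1 / 2))\<^sup>2 = x powr (- 1 / 2 + - 1 / 2)"
    by (simp only: power2_eq_square powr_add)
  then show ?thesis using assms by (simp add: powr_minus_divide)
qed

context cubic_places begin

definition O_unit :: "real \<Rightarrow> bool"
  where "O_unit u \<longleftrightarrow> u \<in> \<O> \<and> (\<exists>v\<in>\<O>. u * v = 1)"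

lemma O_unitD: "O_unit u \<Longrightarrow> u \<in> \<O>"
  by (simp add: O_unit_def)

lemma O_unit_mult:
  assumes "O_unit u" "O_unit v"
  shows "O_unit (u * v)"
proof -
  obtain u' v' where "u \<in> \<O>" "v \<in> \<O>" "u' \<in> \<O>" "v' \<in> \<O>" "u * u' = 1" "v * v' = 1"
    using assms unfolding O_unit_def by blast
  moreover from this have "(u * v) * (u' * v') = 1" by (metis mult.assoc mult.commute mult_1)
  ultimately show ?thesis unfolding O_unit_def by (meson O_mult)
qed

lemma O_unit_power: "O_unit u \<Longrightarrow> O_unit (u ^ n)"
proof (induction n)
  case 0
  show ?case unfolding O_unit_def by (auto intro!: bexI[of _ 1])
qed (simp add: O_unit_mult)

lemma O_unit_nz: "O_unit u \<Longrightarrow> u \<noteq> 0"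
  by (auto simp: O_unit_def)

lemma O_unit_norm: "O_unit u \<Longrightarrow> cmod (t0 u) * cmod (t1 u) * cmod (t2 u) = 1"
  using norm_unit by (auto simp: O_unit_def)

lemma O_unit_congruent:
  assumes "O_unit u" "D > 0"
  shows "u ^ (2 * psi_nat D) - 1 \<in> O_mod D"
  using assms O_unit_power_psi by (auto simp: O_unit_def)

text \<open>The inverse of the unit from \<open>ex_unit\<close> is small at t1 and t2, hence large
  itself by the norm equation; a power of it passes \<open>K\<close>.\<close>

lemma ex_large_unit:
  assumes t0: "\<And>x. x \<in> \<O> \<Longrightarrow> t0 x = of_real x"
  obtains u where "O_unit u" "\<bar>u\<bar> \<ge> K" "\<bar>u\<bar> > 1" "cmod (t1 u) < 1" "cmod (t2 u) < 1"
proof -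
  have "t0 \<gamma> = of_real \<gamma>" by (simp add: t0)
  from ex_unit[OF this] obtain v w where v: "v \<in> \<O>" "w \<in> \<O>" "v * w = 1" "cmod (t1 v) > 1" "cmod (t2 v) > 1"
    by blast
  have w: "O_unit w" using v by (auto simp: O_unit_def mult.commute)
  have inv: "cmod (t w) < 1" if "inj_ring_hom_on \<O> t" "cmod (t v) > 1" for t
  proof -
    have "t v * t w = 1" using hom_mult[OF that(1), of v w] v hom_1[OF that(1)] by simp
    then have "cmod (t v) * cmod (t w) = 1" by (metis norm_mult norm_one)
    moreover have "cmod (t v) \<noteq> 0" using that(2) by linarith
    ultimately have "cmod (t w) = 1 / cmod (t v)"
      by (simp add: nonzero_eq_divide_eq mult.commute)
    then show ?thesis
      by (simp only:, subst divide_less_eq_1_pos) (use that(2) in linarith)+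
  qed
  have t12: "cmod (t1 w) < 1" "cmod (t2 w) < 1"
    using inv hom1 hom2 v by auto
  have w1: "\<bar>w\<bar> > 1"
  proof (rule ccontr)
    assume "\<not> \<bar>w\<bar> > 1"
    then have "\<bar>w\<bar> * cmod (t1 w) * cmod (t2 w) \<le> 1 * 1 * cmod (t2 w)"
      using t12 by (intro mult_mono) auto
    moreover have "\<bar>w\<bar> * cmod (t1 w) * cmod (t2 w) = 1"
      using O_unit_norm[OF w] v(2) by (simp add: t0)
    ultimately show False using t12 by simp
  qed
  \<comment> \<open>The exponent is raised to \<open>Suc k\<close> because \<open>k\<close> may be
    0, which would give the unit 1.\<close>
  obtain k where "K < \<bar>w\<bar> ^ k" using real_arch_pow[OF w1] by blast
  also have "\<bar>w\<bar> ^ k \<le> \<bar>w\<bar> ^ Suc k" using w1 by (intro power_increasing) auto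
  finally have "\<bar>w ^ Suc k\<bar> \<ge> K" unfolding power_abs by simp
  moreover have "\<bar>w ^ Suc k\<bar> > 1" unfolding power_abs using w1 by (rule one_less_power) simp
  moreover have "cmod (t1 (w ^ Suc k)) < 1" "cmod (t2 (w ^ Suc k)) < 1"
    unfolding hom_power[OF hom1 v(2)] hom_power[OF hom2 v(2)] norm_power
    using t12 by (auto simp: power_less_one_iff simp del: power_Suc)
  ultimately show ?thesis using that O_unit_power[OF w] by blast
qed

text \<open>All that the approximation needs from a unit. The factor 2 leaves room for moduli that
  agree only approximately; \<open>K\<close> will force Q to exceed 1; \<delta> is \<epsilon> up to
  a constant.\<close>

definition approx_unit :: "real \<Rightarrow> nat \<Rightarrow> real \<Rightarrow> real \<Rightarrow> bool"
  where "approx_unit K D \<delta> \<eta> \<longleftrightarrow> O_unit \<eta> \<and> \<eta> - 1 \<in> O_mod D \<and> \<bar>\<eta>\<bar> \<ge> K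
    \<and> cmod (t1 \<eta>) \<le> 2 * \<bar>\<eta>\<bar> powr (-1/2) \<and> cmod (t2 \<eta>) \<le> 2 * \<bar>\<eta>\<bar> powr (-1/2)
    \<and> cmod (t1 \<eta> - t2 \<eta>) \<le> \<delta> * \<bar>\<eta>\<bar> powr (-1/2)"

text \<open>The two conjugates have equal modulus automatically, and their difference is twice an
  imaginary part. So one unit suffices, and only the argument of its conjugate has to come close to
  a multiple of 2 pi.\<close>

lemma approx_unit_complex:
  assumes t0: "\<And>x. x \<in> \<O> \<Longrightarrow> t0 x = of_real x" and cnj: "\<And>x. x \<in> \<O> \<Longrightarrow> t2 x = cnj (t1 x)"
    and K: "K \<ge> 1"
  obtains C where "C > 0" "\<And>\<delta> D. 0 < \<delta> \<Longrightarrow> \<delta> \<le> 1 \<Longrightarrow> D > 0 \<Longrightarrow>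
    \<exists>\<eta>. approx_unit K D \<delta> \<eta> \<and> ln \<bar>\<eta>\<bar> \<le> C / \<delta> * real (psi_nat D)"
proof -
  obtain u where u: "O_unit u" "\<bar>u\<bar> \<ge> K" "\<bar>u\<bar> > 1"
    using ex_large_unit[OF t0] by metis
  define C where "C = 2 * (4 * pi + 1) * ln \<bar>u\<bar>"
  have lnu: "ln \<bar>u\<bar> > 0" using u by simp
  have "C > 0" unfolding C_def using lnu by (intro mult_pos_pos) (auto simp: add_pos_pos)
  moreover have "\<exists>\<eta>. approx_unit K D \<delta> \<eta> \<and> ln \<bar>\<eta>\<bar> \<le> C / \<delta> * real (psi_nat D)"
    if \<delta>: "0 < \<delta>" "\<delta> \<le> 1" and D: "D > 0" for \<delta> D
  proof -
    define P where "P = 2 * psi_nat D"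
    have P: "P > 0" using psi_nat_pos[OF D] by (simp add: P_def)
    \<comment> \<open>An error 1/N in Dirichlet's theorem is an angle 2 pi / N \<le> \<delta> / 2;
      doubling the imaginary part gives \<delta>.\<close>
    define N where "N = nat \<lceil>4 * pi / \<delta>\<rceil>"
    have N1: "4 * pi / \<delta> \<le> real N" unfolding N_def by (rule real_nat_ceiling_ge)
    have "4 * pi / \<delta> > 0" using \<delta> by simp
    then have N0: "N > 0" "real N \<le> 4 * pi / \<delta> + 1"
      using N1 by (auto simp: N_def intro: gr0I)
    have "4 * pi / \<delta> + 1 \<le> 4 * pi / \<delta> + 1 / \<delta>" using \<delta> by simp
    with N0(2) have N2: "real N \<le> (4 * pi + 1) / \<delta>" by (simp add: add_divide_distrib)
    define \<phi> where "\<phi> = Arg (t1 u)"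
    \<comment> \<open>The exponent \<open>P\<close> sits inside the number approximated, so it
      enlarges only the size of the unit, not the error.\<close>
    obtain h k where hk: "0 < k" "k \<le> int N" "\<bar>of_int k * (real P * \<phi> / (2 * pi)) - of_int h\<bar> < 1 / real N"
      using Dirichlet_approx[OF N0(1)] by metis
    define m where "m = nat k"
    have m: "0 < m" "m \<le> N" "of_int k = real m" using hk by (auto simp: m_def)
    define \<eta> where "\<eta> = (u ^ m) ^ P"
    have \<eta>u: "\<eta> = u ^ (m * P)" by (simp add: \<eta>_def power_mult)
    have unit: "O_unit \<eta>" unfolding \<eta>_def by (intro O_unit_power u)
    have cong: "\<eta> - 1 \<in> O_mod D"
      unfolding \<eta>_def P_def by (intro O_unit_congruent O_unit_power u D)
    have "\<bar>u\<bar> ^ 1 \<le> \<bar>u\<bar> ^ (m * P)" using u m P by (intro power_increasing) auto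
    then have big: "\<bar>\<eta>\<bar> \<ge> K" unfolding \<eta>u power_abs using u by simp
    have \<eta>O: "\<eta> \<in> \<O>" using unit by (rule O_unitD)
    have "\<bar>\<eta>\<bar> * (cmod (t1 \<eta>))\<^sup>2 = 1"
      using O_unit_norm[OF unit] by (simp add: t0 cnj \<eta>O power2_eq_square)
    then have "(cmod (t1 \<eta>))\<^sup>2 = 1 / \<bar>\<eta>\<bar>" using big K by (auto simp: field_simps)
    also have "\<dots> = (\<bar>\<eta>\<bar> powr (-1/2))\<^sup>2"
      by (rule powr_minus_half_squared[symmetric]) (use big K in linarith)
    finally have r: "cmod (t1 \<eta>) = \<bar>\<eta>\<bar> powr (-1/2)"
      by (simp add: power2_eq_iff_nonneg)
    have "t1 u = of_real (cmod (t1 u)) * cis \<phi>" unfolding \<phi>_def by (simp flip: rcis_def add: rcis_cmod_Arg)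
    then have "t1 \<eta> = (of_real (cmod (t1 u)) * cis \<phi>) ^ (m * P)"
      unfolding \<eta>u by (metis hom_power[OF hom1] u(1) O_unitD)
    also have "\<dots> = of_real (cmod (t1 u) ^ (m * P)) * cis (real (m * P) * \<phi>)"
      by (simp only: power_mult_distrib Complex.DeMoivre of_real_power)
    finally have t1: "t1 \<eta> = of_real (cmod (t1 u) ^ (m * P)) * cis (real (m * P) * \<phi>)" .
    have "cmod (t1 \<eta>) = cmod (t1 u) ^ (m * P)"
      unfolding t1 norm_mult by (simp add: norm_power)
    with r have r': "cmod (t1 u) ^ (m * P) = \<bar>\<eta>\<bar> powr (-1/2)" by simp
    have Im: "Im (t1 \<eta>) = \<bar>\<eta>\<bar> powr (-1/2) * sin (real (m * P) * \<phi>)"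
      unfolding t1 r' by simp
    define \<rho> where "\<rho> = real (m * P) * \<phi> - 2 * pi * of_int h"
    have "\<rho> = 2 * pi * (of_int k * (real P * \<phi> / (2 * pi)) - of_int h)"
      unfolding \<rho>_def m(3) by (simp add: field_simps)
    then have "\<bar>\<rho>\<bar> = 2 * pi * \<bar>of_int k * (real P * \<phi> / (2 * pi)) - of_int h\<bar>"
      by (simp add: abs_mult)
    also have "\<dots> \<le> 2 * pi * (1 / real N)"
      using hk(3) by (intro mult_left_mono) auto
    finally have \<rho>: "\<bar>\<rho>\<bar> \<le> 2 * pi / real N" by simp
    have "real (m * P) * \<phi> = \<rho> + of_int h * (2 * pi)" by (simp add: \<rho>_def)
    then have "sin (real (m * P) * \<phi>) = sin \<rho>"
      using sin.plus_of_int[of \<rho> h] by (simp only: of_real_eq_id id_apply)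
    then have "\<bar>sin (real (m * P) * \<phi>)\<bar> \<le> 2 * pi / real N"
      using \<rho> abs_sin_x_le_abs_x[of \<rho>] by simp
    also have "\<dots> \<le> \<delta> / 2"
      using N1 N0 \<delta> by (simp add: field_simps)
    finally have sin: "\<bar>sin (real (m * P) * \<phi>)\<bar> \<le> \<delta> / 2" .
    have "cmod (t1 \<eta> - t2 \<eta>) = 2 * \<bar>Im (t1 \<eta>)\<bar>"
      using cnj[OF \<eta>O] complex_diff_cnj[of "t1 \<eta>"] by (simp add: norm_mult)
    also have "\<dots> = \<bar>\<eta>\<bar> powr (-1/2) * (2 * \<bar>sin (real (m * P) * \<phi>)\<bar>)"
      unfolding Im by (simp add: abs_mult)
    also have "\<dots> \<le> \<bar>\<eta>\<bar> powr (-1/2) * \<delta>"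
      using sin by (intro mult_left_mono) auto
    finally have diff: "cmod (t1 \<eta> - t2 \<eta>) \<le> \<delta> * \<bar>\<eta>\<bar> powr (-1/2)" by (simp add: mult.commute)
    have "ln \<bar>\<eta>\<bar> = real m * (real P * ln \<bar>u\<bar>)"
      using u unfolding \<eta>u power_abs by (simp add: ln_realpow)
    also have "\<dots> \<le> (4 * pi + 1) / \<delta> * (real P * ln \<bar>u\<bar>)"
      using m(2) N2 lnu by (intro mult_right_mono) auto
    also have "\<dots> = C / \<delta> * real (psi_nat D)"
      unfolding C_def P_def by simp
    finally have "ln \<bar>\<eta>\<bar> \<le> C / \<delta> * real (psi_nat D)" .
    moreover have "approx_unit K D \<delta> \<eta>"
      unfolding approx_unit_def using unit cong big r diff cnj[OF \<eta>O] by simp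
    ultimately show ?thesis by blast
  qed
  ultimately show ?thesis using that by blast
qed

definition lg :: "(real \<Rightarrow> complex) \<Rightarrow> real \<Rightarrow> real"
  where "lg t x = ln (cmod (t x))"

lemma lg_mult_power:
  assumes "inj_ring_hom_on \<O> t" "O_unit u" "O_unit v"
  shows "lg t ((u ^ m * v ^ n) ^ k) = real k * (real m * lg t u + real n * lg t v)"
proof -
  have "t u \<noteq> 0" "t v \<noteq> 0" using hom_inj[OF assms(1)] O_unitD O_unit_nz assms(2,3) by blast+
  then show ?thesis
    using assms(2,3)[THEN O_unitD]
    by (simp add: lg_def hom_power[OF assms(1)] hom_mult[OF assms(1)] norm_mult norm_power ln_realpow ln_mult)
qed

lemma lg_sum:
  assumes "O_unit u"
  shows "lg t0 u + lg t1 u + lg t2 u = 0"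
proof -
  have *: "cmod (t0 u) * cmod (t1 u) * cmod (t2 u) = 1" using assms by (rule O_unit_norm)
  then have "cmod (t0 u) > 0" "cmod (t1 u) > 0" "cmod (t2 u) > 0" by auto
  then have "lg t0 u + lg t1 u + lg t2 u = ln (cmod (t0 u) * cmod (t1 u) * cmod (t2 u))"
    by (simp add: lg_def ln_mult)
  then show ?thesis using * by simp
qed

text \<open>\<open>d\<close> turns products of units into sums, and d \<eta> near 0 means conjugates
  of nearly equal modulus. For \<eta> = (u^m v^n)^P this asks that n / m approximate \<nu> = - d u /
  d v.\<close>

lemma approx_unit_real:
  assumes t0: "\<And>x. x \<in> \<O> \<Longrightarrow> t0 x = of_real x"
    and real: "\<And>x. x \<in> \<O> \<Longrightarrow> t1 x \<in> \<real>" "\<And>x. x \<in> \<O> \<Longrightarrow> t2 x \<in> \<real>"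
    and K: "K \<ge> 1"
  obtains C where "C > 0" "\<And>\<delta> D. 0 < \<delta> \<Longrightarrow> \<delta> \<le> 1 \<Longrightarrow> D > 0 \<Longrightarrow>
    \<exists>\<eta>. approx_unit K D \<delta> \<eta> \<and> ln \<bar>\<eta>\<bar> \<le> C / \<delta> * (real (psi_nat D))\<^sup>2"
proof -
  obtain u where u: "O_unit u" "\<bar>u\<bar> \<ge> K" "\<bar>u\<bar> > 1"
    using ex_large_unit[OF t0] by metis
  define d where "d x = lg t1 x - lg t2 x" for x
  \<comment> \<open>Only nonnegative exponents are used, so \<nu> must be nonnegative:
    \<open>d u\<close> and \<open>d v\<close> may not have the same strict sign.\<close>
  have "\<exists>v. O_unit v \<and> \<bar>v\<bar> > 1 \<and> d v \<noteq> 0 \<and> - d u / d v \<ge> 0"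
  proof -
    \<comment> \<open>Putting t1 or t2 in front yields units that are small at that place and large
      at the other two; their values of \<open>d\<close> have opposite signs, and one of them suits
      \<open>u\<close>.\<close>
    interpret p1: cubic_places \<gamma> a b c t1 t0 t2
      using hom0 hom1 hom2 roots by unfold_locales (auto simp: algebra_simps)
    interpret p2: cubic_places \<gamma> a b c t2 t0 t1
      using hom0 hom1 hom2 roots by unfold_locales (auto simp: algebra_simps)
    have re: "\<exists>\<theta>. z = of_real \<theta>" if "z \<in> \<real>" for z :: complex
      using that by (auto elim: Reals_cases)
    obtain v where v: "O_unit v" "cmod (t0 v) > 1" "cmod (t2 v) > 1"
      using p1.ex_unit re[OF real(1)[OF O_gamma]] unfolding O_unit_def by blast
    obtain w where w: "O_unit w" "cmod (t0 w) > 1" "cmod (t1 w) > 1"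
      using p2.ex_unit re[OF real(2)[OF O_gamma]] unfolding O_unit_def by blast
    have "lg t0 v > 0" "lg t2 v > 0" using v by (auto simp: lg_def intro!: ln_gt_zero)
    then have dv: "d v < 0" using lg_sum[OF v(1)] by (simp add: d_def)
    have "lg t0 w > 0" "lg t1 w > 0" using w by (auto simp: lg_def intro!: ln_gt_zero)
    then have dw: "d w > 0" using lg_sum[OF w(1)] by (simp add: d_def)
    show ?thesis
    proof (cases "d u \<ge> 0")
      case True
      then show ?thesis using v dv O_unitD[OF v(1)]
        by (intro exI[of _ v]) (auto simp: t0 divide_nonneg_neg divide_nonpos_neg)
    next
      case False
      then show ?thesis using w dw O_unitD[OF w(1)]
        by (intro exI[of _ w]) (auto simp: t0 divide_le_0_iff)
    qed
  qed
  then obtain v where v: "O_unit v" "\<bar>v\<bar> > 1" "d v \<noteq> 0" "- d u / d v \<ge> 0" by blast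
  define \<nu> where "\<nu> = - d u / d v"
  have \<nu>: "\<nu> \<ge> 0" using v by (simp add: \<nu>_def)
  define B where "B = ln \<bar>u\<bar> + (\<nu> + 1) * ln \<bar>v\<bar>"
  have lnu: "ln \<bar>u\<bar> > 0" and lnv: "ln \<bar>v\<bar> > 0" using u v by auto
  have B: "B > 0" unfolding B_def using lnu lnv \<nu> by (simp add: add_pos_nonneg)
  \<comment> \<open>4 comes from P^2 = (2 psi(D))^2, the bracket bounds N \<delta> / P, and
    \<open>B\<close> bounds the logarithm of |u^m v^n| divided by N.\<close>
  define C where "C = 4 * (2 * \<bar>d v\<bar> + 1) * B"
  have "C > 0" unfolding C_def using B by (intro mult_pos_pos) auto
  moreover have "\<exists>\<eta>. approx_unit K D \<delta> \<eta> \<and> ln \<bar>\<eta>\<bar> \<le> C / \<delta> * (real (psi_nat D))\<^sup>2"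
    if \<delta>: "0 < \<delta>" "\<delta> \<le> 1" and D: "D > 0" for \<delta> D
  proof -
    define P where "P = 2 * psi_nat D"
    have P: "real P \<ge> 1" "P > 0" using psi_nat_pos[OF D] by (simp_all add: P_def)
    \<comment> \<open>Chosen so that the Dirichlet error 1/N, multiplied by P |d v|, is at most
      \<delta> / 2.\<close>
    define T where "T = 2 * real P * \<bar>d v\<bar> / \<delta>"
    have T: "T > 0" unfolding T_def using \<delta> v P by simp
    define N where "N = nat \<lceil>T\<rceil>"
    have N1: "T \<le> real N" unfolding N_def by (rule real_nat_ceiling_ge)
    then have N0: "N > 0" using T by (auto intro: gr0I)
    have "real N \<le> T + 1" unfolding N_def using T by linarith
    also have "1 \<le> real P / \<delta>" using \<delta> P(1) by (simp add: le_divide_eq)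
    also have "T + real P / \<delta> = (2 * \<bar>d v\<bar> + 1) * real P / \<delta>"
      by (simp add: T_def add_divide_distrib algebra_simps)
    finally have N2: "real N \<le> (2 * \<bar>d v\<bar> + 1) * real P / \<delta>" by simp
    obtain h k where hk: "0 < k" "k \<le> int N" "\<bar>of_int k * \<nu> - of_int h\<bar> < 1 / real N"
      using Dirichlet_approx[OF N0] by metis
    have "1 / real N \<le> 1" using N0 by simp
    then have "\<bar>of_int k * \<nu> - of_int h\<bar> < 1" using hk(3) by linarith
    moreover have "of_int k * \<nu> \<ge> 0" using hk \<nu> by simp
    ultimately have h: "of_int h > (-1 :: real)" "of_int h < of_int k * \<nu> + 1" by linarith+
    then have h0: "h \<ge> 0" by linarith
    define m n where "m = nat k" and "n = nat h"
    have m: "0 < m" "real m \<le> real N" "of_int k = real m" and n: "of_int h = real n"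
      using hk h0 by (auto simp: m_def n_def)
    have nle: "real n \<le> real N * (\<nu> + 1)"
    proof -
      have "real n \<le> real m * \<nu> + 1" using h(2) unfolding m(3) n by simp
      also have "\<dots> \<le> real N * \<nu> + real N" using m \<nu> N0 by (intro add_mono mult_right_mono) auto
      finally show ?thesis by (simp add: algebra_simps)
    qed
    define \<eta> where "\<eta> = (u ^ m * v ^ n) ^ P"
    have unit: "O_unit \<eta>" unfolding \<eta>_def by (intro O_unit_power O_unit_mult u v)
    have \<eta>O: "\<eta> \<in> \<O>" using unit by (rule O_unitD)
    have cong: "\<eta> - 1 \<in> O_mod D"
      unfolding \<eta>_def P_def by (intro O_unit_congruent O_unit_power O_unit_mult u v D)
    note lg = lg_mult_power[OF _ u(1) v(1)]
    have lg0: "lg t0 x = ln \<bar>x\<bar>" if "x \<in> \<O>" for x using that by (simp add: lg_def t0)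
    have ln: "ln \<bar>\<eta>\<bar> = real P * (real m * ln \<bar>u\<bar> + real n * ln \<bar>v\<bar>)"
      using lg[OF hom0, of m n P] lg0[OF \<eta>O] lg0[OF O_unitD[OF u(1)]] lg0[OF O_unitD[OF v(1)]]
      unfolding \<eta>_def[symmetric] by simp
    have "1 * (1 * ln \<bar>u\<bar> + 0) \<le> real P * (real m * ln \<bar>u\<bar> + real n * ln \<bar>v\<bar>)"
      using P m lnu lnv by (intro mult_mono add_mono) auto
    then have "ln \<bar>u\<bar> \<le> ln \<bar>\<eta>\<bar>" unfolding ln by simp
    moreover have "\<eta> \<noteq> 0" using unit by (rule O_unit_nz)
    ultimately have "\<bar>u\<bar> \<le> \<bar>\<eta>\<bar>" using u by simp
    then have big: "\<bar>\<eta>\<bar> \<ge> K" using u by simp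
    have "d \<eta> = real P * (real m * d u + real n * d v)"
      unfolding d_def \<eta>_def lg[OF hom1] lg[OF hom2] by (simp add: algebra_simps)
    also have "d u = - \<nu> * d v" using v by (simp add: \<nu>_def)
    finally have "d \<eta> = - (real P * d v * (of_int k * \<nu> - of_int h))"
      unfolding m(3) n by (simp add: algebra_simps)
    then have "\<bar>d \<eta>\<bar> = real P * \<bar>d v\<bar> * \<bar>of_int k * \<nu> - of_int h\<bar>" by (simp add: abs_mult)
    also have "\<dots> \<le> real P * \<bar>d v\<bar> * (1 / real N)"
      using hk(3) by (intro mult_left_mono) auto
    also have "\<dots> \<le> \<delta> / 2"
      using N1 N0 \<delta> by (simp add: T_def field_simps)
    finally have d\<eta>: "\<bar>d \<eta>\<bar> \<le> \<delta> / 2" .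
    define s where "s = d \<eta> / 2"
    have s: "\<bar>s\<bar> \<le> \<delta> / 4" using d\<eta> by (simp add: s_def)
    define r where "r = \<bar>\<eta>\<bar> powr (-1/2)"
    have r: "r = exp (- ln \<bar>\<eta>\<bar> / 2)" using \<open>\<eta> \<noteq> 0\<close> by (simp add: r_def powr_def)
    \<comment> \<open>\<open>P\<close> is even, so \<eta> is a square and its real conjugates are
      positive; without this, equal moduli could come with opposite signs.\<close>
    have pos: "t \<eta> = of_real (exp (lg t \<eta>))"
      if t: "inj_ring_hom_on \<O> t" and re: "\<And>x. x \<in> \<O> \<Longrightarrow> t x \<in> \<real>" for t
    proof -
      define x where "x = (u ^ m * v ^ n) ^ psi_nat D"
      have x: "x \<in> \<O>" unfolding x_def by (intro O_unitD O_unit_power O_unit_mult u v)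
      have "\<eta> = x ^ 2" unfolding \<eta>_def x_def P_def by (simp add: mult.commute flip: power_mult)
      moreover obtain y where y: "t x = of_real y" using re[OF x] by (auto elim: Reals_cases)
      ultimately have t\<eta>: "t \<eta> = of_real (y\<^sup>2)" by (simp add: hom_power[OF t] x)
      moreover have "t \<eta> \<noteq> 0" using hom_inj[OF t \<eta>O] \<open>\<eta> \<noteq> 0\<close> by blast
      ultimately have "exp (lg t \<eta>) = y\<^sup>2" by (simp add: lg_def norm_power)
      with t\<eta> show ?thesis by simp
    qed
    \<comment> \<open>The three logarithms sum to 0, so the two conjugates lie symmetrically about
      |\<eta>|^(-1/2), off by the factors e^s and e^(-s).\<close>
    have lg12: "lg t1 \<eta> = - ln \<bar>\<eta>\<bar> / 2 + s" "lg t2 \<eta> = - ln \<bar>\<eta>\<bar> / 2 + (- s)"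
      using lg_sum[OF unit] lg0[OF \<eta>O] by (simp_all add: s_def d_def field_simps)
    have t1: "t1 \<eta> = of_real (r * exp s)" and t2: "t2 \<eta> = of_real (r * exp (- s))"
      using pos[OF hom1 real(1)] pos[OF hom2 real(2)] by (simp_all only: lg12 r exp_add)
    have e: "exp y \<le> 1 + 2 * \<bar>y\<bar>" "exp y \<ge> 1 - \<bar>y\<bar>" if "\<bar>y\<bar> \<le> 1 / 2" for y :: real
    proof -
      show "exp y \<le> 1 + 2 * \<bar>y\<bar>"
        using exp_bound_half[of y] that by (smt (verit) real_norm_def exp_bound_lemma)
      show "exp y \<ge> 1 - \<bar>y\<bar>" using exp_ge_add_one_self[of y] by linarith
    qed
    have s2: "\<bar>s\<bar> \<le> 1 / 2" "\<bar>- s\<bar> \<le> 1 / 2" using s \<delta> by auto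
    have r0: "r \<ge> 0" by (simp add: r_def)
    \<comment> \<open>The difference is at most (1 + 2|s|) - (1 - |s|) = 3|s| \<le> 3 \<delta> /
      4.\<close>
    have e2: "exp s \<le> 2" "exp (- s) \<le> 2" "\<bar>exp s - exp (- s)\<bar> \<le> \<delta>"
      using e[OF s2(1)] e[OF s2(2)] s \<delta> by (simp_all add: abs_le_iff)
    have "cmod (t1 \<eta>) \<le> 2 * r" "cmod (t2 \<eta>) \<le> 2 * r"
      unfolding t1 t2 norm_of_real abs_mult using e2 r0 by (simp_all add: mult.commute[of 2] mult_left_mono)
    moreover have "t1 \<eta> - t2 \<eta> = of_real (r * (exp s - exp (- s)))"
      unfolding t1 t2 by (simp add: algebra_simps)
    then have "cmod (t1 \<eta> - t2 \<eta>) = r * \<bar>exp s - exp (- s)\<bar>"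
      using r0 by (simp only: norm_of_real abs_mult abs_of_nonneg)
    then have "cmod (t1 \<eta> - t2 \<eta>) \<le> \<delta> * r"
      using e2(3) r0 by (simp add: mult.commute[of \<delta>] mult_left_mono)
    ultimately have appr: "approx_unit K D \<delta> \<eta>"
      unfolding approx_unit_def r_def using unit cong big by simp
    have "ln \<bar>\<eta>\<bar> \<le> real P * (real N * ln \<bar>u\<bar> + real N * (\<nu> + 1) * ln \<bar>v\<bar>)"
      unfolding ln using m nle lnu lnv by (intro mult_left_mono add_mono mult_right_mono) auto
    then have "ln \<bar>\<eta>\<bar> \<le> real P * B * real N" by (simp add: B_def algebra_simps)
    also have "\<dots> \<le> real P * B * ((2 * \<bar>d v\<bar> + 1) * real P / \<delta>)"
      using N2 B by (intro mult_left_mono) auto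
    also have "\<dots> = C / \<delta> * (real (psi_nat D))\<^sup>2"
      unfolding C_def P_def by (simp add: power2_eq_square)
    finally have "ln \<bar>\<eta>\<bar> \<le> C / \<delta> * (real (psi_nat D))\<^sup>2" by simp
    with appr show ?thesis by blast
  qed
  ultimately show ?thesis using that by blast
qed

end

section \<open>From units to approximations\<close>

definition lattice3 :: "real \<Rightarrow> real \<Rightarrow> real set"
  where "lattice3 \<alpha> \<beta> = {of_int x + of_int y * \<alpha> + of_int z * \<beta> | x y z. True}"

text \<open>The functional \<open>w\<^sub>0 + w\<^sub>1 t\<^sub>1 + w\<^sub>2 t\<^sub>2\<close> is the trace against the element of the dual basis
  of \<open>1, \<alpha>, \<beta>\<close> that belongs to \<open>\<beta>\<close>.\<close>

locale cubic_approx = cubic_places \<gamma> a b c "of_real :: real \<Rightarrow> complex" t1 t2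
  for \<gamma> a b c t1 t2 +
  fixes E :: "real set" and \<alpha> \<beta> :: real and w0 w1 w2 :: complex
  assumes homE1: "inj_ring_hom_on E t1" and homE2: "inj_ring_hom_on E t2"
    and E_subring: "x \<in> E \<Longrightarrow> y \<in> E \<Longrightarrow> x + y \<in> E" "x \<in> E \<Longrightarrow> y \<in> E \<Longrightarrow> x * y \<in> E" "\<O> \<subseteq> E"
    and basis_E: "\<alpha> \<in> E" "\<beta> \<in> E"
    and lattice: "x \<in> \<O> \<Longrightarrow> y \<in> lattice3 \<alpha> \<beta> \<Longrightarrow> x * y \<in> lattice3 \<alpha> \<beta>"
    and w: "w0 + w1 + w2 = 0" "w0 * of_real \<alpha> + w1 * t1 \<alpha> + w2 * t2 \<alpha> = 0"
      "w0 * of_real \<beta> + w1 * t1 \<beta> + w2 * t2 \<beta> = 1" "w0 \<noteq> 0"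
begin

definition \<tau> :: "real \<Rightarrow> complex"
  where "\<tau> x = w0 * of_real x + w1 * t1 x + w2 * t2 x"

lemma of_int_E: "of_int n \<in> E"
  using E_subring(3) O_of_int by blast

lemma tau_add: "x \<in> E \<Longrightarrow> y \<in> E \<Longrightarrow> \<tau> (x + y) = \<tau> x + \<tau> y"
  using homE1 homE2 by (simp add: \<tau>_def inj_ring_hom_on_def algebra_simps)

lemma tau_of_int_mult: "x \<in> E \<Longrightarrow> \<tau> (of_int n * x) = of_int n * \<tau> x"
  using homE1 homE2 of_int_E[of n]
  by (simp add: \<tau>_def inj_ring_hom_on_def hom_of_int[OF hom1] hom_of_int[OF hom2] algebra_simps)

lemma tau_basis: "\<tau> 1 = 0" "\<tau> \<alpha> = 0" "\<tau> \<beta> = 1"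
  using w homE1 homE2 by (simp_all add: \<tau>_def inj_ring_hom_on_def)

lemma tau_combination:
  assumes "x \<in> E" "y \<in> E" "z \<in> E"
  shows "\<tau> (of_int i * x + of_int j * y + of_int k * z) = of_int i * \<tau> x + of_int j * \<tau> y + of_int k * \<tau> z"
  using assms by (simp add: tau_add tau_of_int_mult E_subring of_int_E)

lemma tau_lattice:
  assumes "x \<in> lattice3 \<alpha> \<beta>"
  obtains k :: int where "\<tau> x = of_int k"
proof -
  obtain i j k where "x = of_int i * 1 + of_int j * \<alpha> + of_int k * \<beta>"
    using assms by (auto simp: lattice3_def)
  then have "\<tau> x = of_int k"
    using tau_combination[of 1 \<alpha> \<beta> i j k] basis_E of_int_E[of 1] by (simp add: tau_basis)
  then show ?thesis by (rule that)
qed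

lemma basis_lattice: "1 \<in> lattice3 \<alpha> \<beta>" "\<alpha> \<in> lattice3 \<alpha> \<beta>" "\<beta> \<in> lattice3 \<alpha> \<beta>"
proof -
  have "of_int x + of_int y * \<alpha> + of_int z * \<beta> \<in> lattice3 \<alpha> \<beta>" for x y z
    by (auto simp: lattice3_def)
  from this[of 1 0 0] this[of 0 1 0] this[of 0 0 1]
  show "1 \<in> lattice3 \<alpha> \<beta>" "\<alpha> \<in> lattice3 \<alpha> \<beta>" "\<beta> \<in> lattice3 \<alpha> \<beta>" by simp_all
qed

lemma tau_O_mult:
  assumes "\<eta> \<in> \<O>" "x \<in> E"
  shows "\<tau> (\<eta> * x) = w0 * (of_real \<eta> * of_real x) + w1 * (t1 \<eta> * t1 x) + w2 * (t2 \<eta> * t2 x)"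
  using assms homE1 homE2 E_subring(3) by (auto simp: \<tau>_def inj_ring_hom_on_def)

lemma unit_triple:
  assumes unit: "O_unit \<eta>" and cong: "\<eta> - 1 \<in> O_mod D"
  obtains Q R S :: int where
    "\<tau> \<eta> = of_int Q" "\<tau> (\<eta> * \<alpha>) = of_int R" "\<tau> (\<eta> * \<beta>) = of_int S"
    "Gcd {Q, R, S} = 1" "int D dvd Q" "int D dvd R"
proof -
  obtain v where v: "\<eta> \<in> \<O>" "v \<in> \<O>" "\<eta> * v = 1" using unit by (auto simp: O_unit_def)
  obtain Q R S :: int where QRS:
    "\<tau> (\<eta> * 1) = of_int Q" "\<tau> (\<eta> * \<alpha>) = of_int R" "\<tau> (\<eta> * \<beta>) = of_int S"
    using tau_lattice[OF lattice[OF v(1) basis_lattice(1)]] tau_lattice[OF lattice[OF v(1) basis_lattice(2)]]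
      tau_lattice[OF lattice[OF v(1) basis_lattice(3)]] by metis
  have E: "\<eta> \<in> E" "\<eta> * \<alpha> \<in> E" "\<eta> * \<beta> \<in> E" using v E_subring basis_E by blast+
  \<comment> \<open>Since v \<beta> has integer coordinates, applying \<tau> to \<beta> = \<eta> (v
    \<beta>) yields a Bezout relation for Q, R, S.\<close>
  have "v * \<beta> \<in> lattice3 \<alpha> \<beta>" using lattice v basis_lattice by blast
  then obtain i j k where ijk: "v * \<beta> = of_int i + of_int j * \<alpha> + of_int k * \<beta>"
    by (auto simp: lattice3_def)
  have "\<beta> = \<eta> * (v * \<beta>)" using v by (simp flip: mult.assoc)
  also have "\<dots> = of_int i * \<eta> + of_int j * (\<eta> * \<alpha>) + of_int k * (\<eta> * \<beta>)"
    unfolding ijk by (simp add: algebra_simps)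
  finally have "\<tau> \<beta> = of_int i * of_int Q + of_int j * of_int R + of_int k * of_int S"
    using tau_combination[OF E, of i j k] QRS by simp
  then have "of_int (i * Q + j * R + k * S) = (of_int 1 :: complex)"
    by (simp add: tau_basis)
  then have one: "i * Q + j * R + k * S = 1" by (simp only: of_int_eq_iff)
  have "Gcd {Q, R, S} dvd i * Q + j * R + k * S"
    by (intro dvd_add dvd_mult Gcd_dvd) auto
  then have gcd: "Gcd {Q, R, S} = 1"
    unfolding one using Gcd_int_greater_eq_0[of "{Q, R, S}"] by simp
  obtain t where t: "t \<in> \<O>" "\<eta> = 1 + of_int (int D) * t"
    using cong by (auto simp: O_mod_def algebra_simps)
  \<comment> \<open>\<tau> (\<eta> x) = \<tau> x + D \<tau> (t x), so the congruence holds where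
    \<tau> vanishes: at 1 and \<alpha>, but not at \<beta>.\<close>
  have dvd: "int D dvd n" if x: "x \<in> lattice3 \<alpha> \<beta>" "x \<in> E" "\<tau> x = 0" and n: "\<tau> (\<eta> * x) = of_int n" for x n
  proof -
    obtain m where m: "\<tau> (t * x) = of_int m"
      using tau_lattice[OF lattice[OF t(1) x(1)]] by metis
    have tx: "t * x \<in> E" using t E_subring x by blast
    have "\<eta> * x = of_int 1 * x + of_int (int D) * (t * x) + of_int 0 * x"
      unfolding t by (simp add: algebra_simps)
    then have "of_int n = (of_int (int D * m) :: complex)"
      using tau_combination[OF x(2) tx x(2), of 1 "int D" 0] n m x(3) by simp
    then have "n = int D * m" by (simp only: of_int_eq_iff)
    then show ?thesis by simp
  qed
  have "int D dvd Q" "int D dvd R"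
    using dvd[OF basis_lattice(1) _ _ QRS(1)] dvd[OF basis_lattice(2) _ _ QRS(2)] of_int_E[of 1] basis_E
    by (simp_all add: tau_basis)
  with that QRS gcd show ?thesis by simp
qed

lemma approximation:
  obtains K A W where "K \<ge> 1" "A > 0" "W \<ge> 1"
    "\<And>\<eta> D \<delta>. approx_unit K D \<delta> \<eta> \<Longrightarrow> \<exists>Q R S :: int. Q > 1 \<and> Gcd {Q, R, S} = 1
      \<and> \<bar>of_int Q * \<alpha> - of_int R\<bar> \<le> A * \<delta> * of_int Q powr (-1/2)
      \<and> \<bar>of_int Q * \<beta> - of_int S\<bar> \<le> A * of_int Q powr (-1/2)
      \<and> [Q = 0] (mod int D) \<and> [R = 0] (mod int D)
      \<and> ln (of_int Q) \<le> ln W + ln \<bar>\<eta>\<bar>"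
proof -
  \<comment> \<open>\<open>B\<close> bounds the contribution of the two small conjugates to Q. Then
    |Q| \<le> W |\<eta>|, and \<open>K\<close> solves |w0| K - B = |w0| + 2, which forces |Q| > 1.
    The root of \<open>W\<close> converts |\<eta>|^(-1/2) into |Q|^(-1/2).\<close>
  define B where "B = 2 * (cmod w1 + cmod w2)"
  define W where "W = 1 + cmod w0 + B"
  define K where "K = 1 + (2 + B) / cmod w0"
  define A1 where "A1 = cmod (w1 * (of_real \<alpha> - t1 \<alpha>))"
  define A2 where "A2 = 2 * cmod (w1 * (of_real \<beta> - t1 \<beta>)) + 2 * cmod (w2 * (of_real \<beta> - t2 \<beta>))"
  define A where "A = (1 + A1 + A2) * sqrt W"
  have B0: "B \<ge> 0" by (simp add: B_def)
  have w0: "cmod w0 > 0" using w by simp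
  have W: "W \<ge> 1" using B0 by (simp add: W_def)
  have K: "K \<ge> 1" using B0 w0 by (simp add: K_def)
  have A0: "A1 \<ge> 0" "A2 \<ge> 0" by (simp_all add: A1_def A2_def)
  then have A: "A > 0" using W by (simp add: A_def)
  moreover have "\<exists>Q R S :: int. Q > 1 \<and> Gcd {Q, R, S} = 1
      \<and> \<bar>of_int Q * \<alpha> - of_int R\<bar> \<le> A * \<delta> * of_int Q powr (-1/2)
      \<and> \<bar>of_int Q * \<beta> - of_int S\<bar> \<le> A * of_int Q powr (-1/2)
      \<and> [Q = 0] (mod int D) \<and> [R = 0] (mod int D)
      \<and> ln (of_int Q) \<le> ln W + ln \<bar>\<eta>\<bar>" if "approx_unit K D \<delta> \<eta>" for \<eta> D \<delta>
  proof -
    have unit: "O_unit \<eta>" and cong: "\<eta> - 1 \<in> O_mod D" and big: "\<bar>\<eta>\<bar> \<ge> K"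
      and t1: "cmod (t1 \<eta>) \<le> 2 * \<bar>\<eta>\<bar> powr (-1/2)" and t2: "cmod (t2 \<eta>) \<le> 2 * \<bar>\<eta>\<bar> powr (-1/2)"
      and t12: "cmod (t1 \<eta> - t2 \<eta>) \<le> \<delta> * \<bar>\<eta>\<bar> powr (-1/2)"
      using that by (auto simp: approx_unit_def)
    have \<eta>O: "\<eta> \<in> \<O>" using unit by (rule O_unitD)
    have \<eta>1: "\<bar>\<eta>\<bar> \<ge> 1" using big K by simp
    define r where "r = \<bar>\<eta>\<bar> powr (-1/2)"
    have r: "0 \<le> r" "r \<le> 1" using \<eta>1 powr_mono[of "-1/2" 0 "\<bar>\<eta>\<bar>"] by (auto simp: r_def split: if_splits)
    have \<delta>: "\<delta> * r \<ge> 0" using t12 norm_ge_zero order_trans unfolding r_def by blast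
    obtain Q R S where QRS: "\<tau> \<eta> = of_int Q" "\<tau> (\<eta> * \<alpha>) = of_int R" "\<tau> (\<eta> * \<beta>) = of_int S"
      and gcd: "Gcd {Q, R, S} = 1" and dvd: "int D dvd Q" "int D dvd R"
      using unit_triple[OF unit cong] by metis
    have tail: "cmod (w1 * t1 \<eta> + w2 * t2 \<eta>) \<le> B"
    proof -
      have "cmod (w1 * t1 \<eta> + w2 * t2 \<eta>) \<le> cmod w1 * cmod (t1 \<eta>) + cmod w2 * cmod (t2 \<eta>)"
        by (metis norm_mult norm_triangle_ineq)
      also have "\<dots> \<le> cmod w1 * 2 + cmod w2 * 2"
        using t1 t2 r unfolding r_def by (intro add_mono mult_left_mono) auto
      finally show ?thesis by (simp add: B_def)
    qed
    have Q_eq: "of_int Q = w0 * of_real \<eta> + (w1 * t1 \<eta> + w2 * t2 \<eta>)"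
      unfolding QRS(1)[symmetric] \<tau>_def by (simp add: add.assoc)
    have nQ: "cmod (of_int Q) = \<bar>of_int Q\<bar>" by simp
    have "cmod (of_int Q) \<le> cmod w0 * \<bar>\<eta>\<bar> + B"
      unfolding Q_eq using tail norm_triangle_ineq[of "w0 * of_real \<eta>" "w1 * t1 \<eta> + w2 * t2 \<eta>"]
      by (simp add: norm_mult)
    also have "\<dots> \<le> cmod w0 * \<bar>\<eta>\<bar> + B * \<bar>\<eta>\<bar>"
      using mult_left_mono[OF \<eta>1 B0] by simp
    also have "\<dots> \<le> W * \<bar>\<eta>\<bar>" by (simp add: W_def algebra_simps)
    finally have Q_le: "\<bar>of_int Q\<bar> \<le> W * \<bar>\<eta>\<bar>" unfolding nQ .
    have "cmod w0 * K = cmod w0 + 2 + B" using w0 by (simp add: K_def field_simps)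
    moreover have "cmod w0 * K \<le> cmod w0 * \<bar>\<eta>\<bar>" using big by (intro mult_left_mono) auto
    moreover have "cmod (of_int Q) \<ge> cmod w0 * \<bar>\<eta>\<bar> - B"
      unfolding Q_eq using tail norm_diff_ineq[of "w0 * of_real \<eta>" "w1 * t1 \<eta> + w2 * t2 \<eta>"]
      by (simp add: norm_mult)
    ultimately have "\<bar>of_int Q\<bar> > (1 :: real)" using w0 unfolding nQ by linarith
    then have Q1: "\<bar>Q\<bar> > 1" by linarith
    define q where "q = real_of_int \<bar>Q\<bar>"
    have q: "q > 1" "q \<le> W * \<bar>\<eta>\<bar>" using Q1 Q_le by (simp_all add: q_def)
    have rq: "r \<le> sqrt W * q powr (-1/2)"
    proof -
      have "r = sqrt W * (W * \<bar>\<eta>\<bar>) powr (-1/2)"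
        using W by (simp add: r_def powr_mult powr_minus powr_half_sqrt)
      also have "\<dots> \<le> sqrt W * q powr (-1/2)"
        using q W by (intro mult_left_mono powr_mono2') auto
      finally show ?thesis .
    qed
    have "(of_int Q * of_real \<alpha> - of_int R :: complex) = w1 * t1 \<eta> * (of_real \<alpha> - t1 \<alpha>) + w2 * t2 \<eta> * (of_real \<alpha> - t2 \<alpha>)"
      unfolding QRS(2)[symmetric] tau_O_mult[OF \<eta>O basis_E(1)] Q_eq by (simp add: algebra_simps)
    \<comment> \<open>The relations w(1,2) say w2 (\<alpha> - t2 \<alpha>) = - w1 (\<alpha> - t1
      \<alpha>), so only the difference of the conjugates survives.\<close>
    also have "\<dots> = w1 * (of_real \<alpha> - t1 \<alpha>) * (t1 \<eta> - t2 \<eta>)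
      + t2 \<eta> * ((w0 + w1 + w2) * of_real \<alpha> - (w0 * of_real \<alpha> + w1 * t1 \<alpha> + w2 * t2 \<alpha>))"
      by (simp add: algebra_simps)
    also have "\<dots> = w1 * (of_real \<alpha> - t1 \<alpha>) * (t1 \<eta> - t2 \<eta>)"
      unfolding w(1,2) by simp
    finally have "cmod (of_real (of_int Q * \<alpha> - of_int R)) = A1 * cmod (t1 \<eta> - t2 \<eta>)"
      unfolding A1_def by (simp add: norm_mult)
    then have "\<bar>of_int Q * \<alpha> - of_int R\<bar> = A1 * cmod (t1 \<eta> - t2 \<eta>)"
      by (simp only: norm_of_real)
    also have "\<dots> \<le> A1 * (\<delta> * r)"
      using t12 A0 unfolding r_def by (intro mult_left_mono) auto
    also have "\<dots> \<le> (1 + A1 + A2) * (\<delta> * r)"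
      using A0 \<delta> by (intro mult_right_mono) auto
    finally have 1: "\<bar>of_int Q * \<alpha> - of_int R\<bar> \<le> (1 + A1 + A2) * (\<delta> * r)" .
    have R_le: "\<bar>of_int Q * \<alpha> - of_int R\<bar> \<le> A * \<delta> * q powr (-1/2)"
    proof (cases "r = 0")
      case True
      then show ?thesis using \<eta>1 by (simp add: r_def)
    next
      case False
      then have "\<delta> \<ge> 0" using \<delta> r by (simp add: zero_le_mult_iff)
      then have "(1 + A1 + A2) * (\<delta> * r) \<le> (1 + A1 + A2) * (\<delta> * (sqrt W * q powr (-1/2)))"
        using rq A0 by (intro mult_left_mono) auto
      with 1 show ?thesis by (simp add: A_def mult_ac)
    qed
    have "(of_int Q * of_real \<beta> - of_int S :: complex)
        = w1 * (of_real \<beta> - t1 \<beta>) * t1 \<eta> + w2 * (of_real \<beta> - t2 \<beta>) * t2 \<eta>"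
      unfolding QRS(3)[symmetric] tau_O_mult[OF \<eta>O basis_E(2)] Q_eq by (simp add: algebra_simps)
    then have "cmod (of_real (of_int Q * \<beta> - of_int S))
        \<le> cmod (w1 * (of_real \<beta> - t1 \<beta>)) * cmod (t1 \<eta>) + cmod (w2 * (of_real \<beta> - t2 \<beta>)) * cmod (t2 \<eta>)"
      by (simp flip: norm_mult add: norm_triangle_ineq)
    also have "\<dots> \<le> cmod (w1 * (of_real \<beta> - t1 \<beta>)) * (2 * r) + cmod (w2 * (of_real \<beta> - t2 \<beta>)) * (2 * r)"
      using t1 t2 unfolding r_def by (intro add_mono mult_left_mono) auto
    also have "\<dots> = A2 * r" by (simp add: A2_def algebra_simps)
    also have "\<dots> \<le> (1 + A1 + A2) * (sqrt W * q powr (-1/2))"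
      using A0 rq r by (intro mult_mono) auto
    finally have S_le: "\<bar>of_int Q * \<beta> - of_int S\<bar> \<le> A * q powr (-1/2)"
      by (simp only: norm_of_real A_def mult.assoc)
    have "ln q \<le> ln (W * \<bar>\<eta>\<bar>)" using q by simp
    also have "\<dots> = ln W + ln \<bar>\<eta>\<bar>" using W \<eta>1 by (intro ln_mult_pos) auto
    finally have lnq: "ln q \<le> ln W + ln \<bar>\<eta>\<bar>" .
    \<comment> \<open>Q may be negative; the whole triple is multiplied by its sign.\<close>
    define \<sigma> where "\<sigma> = sgn Q"
    have \<sigma>: "\<sigma> * Q = \<bar>Q\<bar>" "\<bar>\<sigma>\<bar> = 1" using Q1 by (auto simp: \<sigma>_def abs_sgn mult.commute)
    have flip: "\<bar>of_int \<bar>Q\<bar> * x - of_int (\<sigma> * Y)\<bar> = \<bar>of_int Q * x - of_int Y\<bar>" for x :: real and Y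
    proof -
      have "of_int \<bar>Q\<bar> * x - of_int (\<sigma> * Y) = of_int \<sigma> * (of_int Q * x - of_int Y)"
        unfolding \<sigma>(1)[symmetric] by (simp add: algebra_simps)
      moreover have "\<bar>of_int \<sigma>\<bar> = (1 :: real)" using \<sigma>(2) by linarith
      ultimately show ?thesis by (simp add: abs_mult)
    qed
    have "\<sigma> = 1 \<or> \<sigma> = - 1" using \<sigma>(2) by linarith
    then have "Gcd {\<bar>Q\<bar>, \<sigma> * R, \<sigma> * S} = 1" using gcd by auto
    moreover have "[\<bar>Q\<bar> = 0] (mod int D)" "[\<sigma> * R = 0] (mod int D)"
      using dvd by (simp_all add: cong_0_iff)
    ultimately show ?thesis
      using Q1 R_le S_le lnq unfolding q_def flip[symmetric]
      by (intro exI[of _ "\<bar>Q\<bar>"] exI[of _ "\<sigma> * R"] exI[of _ "\<sigma> * S"]) simp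
  qed
  ultimately show ?thesis using that K W by blast
qed

end

section \<open>Conjugates in a cubic field\<close>

lemma of_real_of_rat: "complex_of_real (of_rat x) = of_rat x"
  by (cases x) (simp add: of_rat_rat)

text \<open>The last summands are the coordinates p r, p q + r, p^2 + q of \<theta>^4.\<close>

lemma cubic_mult:
  fixes \<theta> :: "'a :: comm_ring_1"
  assumes "\<theta> ^ 3 = p * \<theta>\<^sup>2 + q * \<theta> + r"
  shows "(u + v * \<theta> + w * \<theta>\<^sup>2) * (u' + v' * \<theta> + w' * \<theta>\<^sup>2)
    = (u * u' + (v * w' + w * v') * r + w * w' * (p * r))
      + (u * v' + v * u' + (v * w' + w * v') * q + w * w' * (p * q + r)) * \<theta>
      + (u * w' + v * v' + w * u' + (v * w' + w * v') * p + w * w' * (p\<^sup>2 + q)) * \<theta>\<^sup>2" (is "_ = ?rhs")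
proof -
  have "\<theta> ^ 3 * \<theta> = (p * \<theta>\<^sup>2 + q * \<theta> + r) * \<theta>" by (simp only: assms(1))
  then have 4: "\<theta> ^ 3 * \<theta> = p * \<theta> ^ 3 + q * \<theta>\<^sup>2 + r * \<theta>"
    by (simp add: algebra_simps power2_eq_square power3_eq_cube)
  have "(u + v * \<theta> + w * \<theta>\<^sup>2) * (u' + v' * \<theta> + w' * \<theta>\<^sup>2)
    = u * u' + (u * v' + v * u') * \<theta> + (u * w' + v * v' + w * u') * \<theta>\<^sup>2
      + (v * w' + w * v') * \<theta> ^ 3 + w * w' * (\<theta> ^ 3 * \<theta>)"
    by (simp add: algebra_simps power2_eq_square power3_eq_cube)
  also have "\<dots> = ?rhs"
    unfolding 4 unfolding assms(1) by (simp add: algebra_simps power2_eq_square)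
  finally show ?thesis .
qed

text \<open>Polymorphic in the field, so that the same rational coordinates can be evaluated at
  \<alpha> and at its complex conjugates.\<close>

definition quad :: "'a :: field_char_0 \<Rightarrow> rat \<Rightarrow> rat \<Rightarrow> rat \<Rightarrow> 'a"
  where "quad \<theta> u v w = of_rat u + of_rat v * \<theta> + of_rat w * \<theta>\<^sup>2"

lemma quad_add: "quad \<theta> u v w + quad \<theta> u' v' w' = quad \<theta> (u + u') (v + v') (w + w')"
  by (simp add: quad_def of_rat_add algebra_simps)

lemma quad_diff: "quad \<theta> u v w - quad \<theta> u' v' w' = quad \<theta> (u - u') (v - v') (w - w')"
  by (simp add: quad_def of_rat_diff algebra_simps)

lemma quad_mult:
  assumes "\<theta> ^ 3 = quad \<theta> r q p"
  shows "quad \<theta> u v w * quad \<theta> u' v' w' = quad \<theta>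
      (u * u' + (v * w' + w * v') * r + w * w' * (p * r))
      (u * v' + v * u' + (v * w' + w * v') * q + w * w' * (p * q + r))
      (u * w' + v * v' + w * u' + (v * w' + w * v') * p + w * w' * (p\<^sup>2 + q))"
proof -
  have "\<theta> ^ 3 = of_rat p * \<theta>\<^sup>2 + of_rat q * \<theta> + of_rat r"
    using assms by (simp add: quad_def)
  from cubic_mult[OF this] show ?thesis
    by (simp add: quad_def of_rat_add of_rat_mult of_rat_power)
qed

locale cubic_field =
  fixes E :: "real set" and \<alpha> :: real and p q r :: rat
  assumes mem_E: "x \<in> E \<longleftrightarrow> (\<exists>u v w. x = quad \<alpha> u v w)"
    and quad_eq_0: "quad \<alpha> u v w = 0 \<Longrightarrow> u = 0 \<and> v = 0 \<and> w = 0"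
    and inverse_E: "x \<in> E \<Longrightarrow> x \<noteq> 0 \<Longrightarrow> inverse x \<in> E"
    and minpoly: "\<alpha> ^ 3 = quad \<alpha> r q p"
begin

lemma quad_E: "quad \<alpha> u v w \<in> E"
  unfolding mem_E by blast

lemma quad_inject: "quad \<alpha> u v w = quad \<alpha> u' v' w' \<longleftrightarrow> u = u' \<and> v = v' \<and> w = w'"
  using quad_eq_0[of "u - u'" "v - v'" "w - w'"] by (auto simp flip: quad_diff)

lemma add_E: "x \<in> E \<Longrightarrow> y \<in> E \<Longrightarrow> x + y \<in> E"
  unfolding mem_E by (metis quad_add)

lemma mult_E: "x \<in> E \<Longrightarrow> y \<in> E \<Longrightarrow> x * y \<in> E"
  unfolding mem_E by (metis quad_mult[OF minpoly])

text \<open>Evaluation at \<theta> instead of \<alpha>, well defined by uniqueness of coordinates;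
  \<open>restrict\<close> makes it extensional, as \<open>embeddings\<close> demands.\<close>

definition emb :: "'a :: field_char_0 \<Rightarrow> real \<Rightarrow> 'a"
  where "emb \<theta> = restrict (\<lambda>x. THE y. \<exists>u v w. x = quad \<alpha> u v w \<and> y = quad \<theta> u v w) E"

lemma emb_quad: "emb \<theta> (quad \<alpha> u v w) = quad \<theta> u v w"
proof -
  have "(THE y. \<exists>u' v' w'. quad \<alpha> u v w = quad \<alpha> u' v' w' \<and> y = quad \<theta> u' v' w') = quad \<theta> u v w"
    by (rule the_equality) (auto simp: quad_inject)
  then show ?thesis by (simp add: emb_def quad_E)
qed

lemma emb_alpha: "emb \<theta> \<alpha> = \<theta>"
  using emb_quad[of \<theta> 0 1 0] by (simp add: quad_def)

lemma emb_inj_ring_hom: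
  assumes "\<theta> ^ 3 = quad \<theta> r q p"
  shows "inj_ring_hom_on E (emb \<theta>)"
proof -
  have 1: "emb \<theta> 1 = 1" using emb_quad[of \<theta> 1 0 0] by (simp add: quad_def)
  have 0: "emb \<theta> 0 = 0" using emb_quad[of \<theta> 0 0 0] by (simp add: quad_def)
  have add: "emb \<theta> (x + y) = emb \<theta> x + emb \<theta> y" if "x \<in> E" "y \<in> E" for x y
    using that unfolding mem_E by (auto simp: emb_quad quad_add)
  have mult: "emb \<theta> (x * y) = emb \<theta> x * emb \<theta> y" if "x \<in> E" "y \<in> E" for x y
    using that unfolding mem_E by (auto simp: emb_quad quad_mult[OF minpoly] quad_mult[OF assms])
  have "x = 0" if "x \<in> E" "emb \<theta> x = 0" for x
  proof (rule ccontr)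
    assume "x \<noteq> 0"
    then show False using mult[OF that(1) inverse_E[OF that(1)]] that 1 by simp
  qed
  with 1 add mult show ?thesis unfolding inj_ring_hom_on_def by blast
qed

lemma emb_embeddings:
  assumes "\<theta> ^ 3 = quad \<theta> r q p"
  shows "emb \<theta> \<in> embeddings E"
proof -
  have "emb \<theta> \<in> extensional E" by (simp add: emb_def)
  moreover have "emb \<theta> \<in> ring_hom (ring_of_type_algebra\<lparr>carrier := E\<rparr>) ring_of_type_algebra"
    using emb_inj_ring_hom[OF assms]
    by (intro ring_hom_memI) (auto simp: ring_of_type_algebra_def inj_ring_hom_on_def)
  ultimately show ?thesis by (simp add: embeddings_def)
qed

lemma emb_of_real: "x \<in> E \<Longrightarrow> emb (complex_of_real \<theta>) x \<in> \<real>"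
proof -
  assume "x \<in> E"
  then obtain u v w where x: "x = quad \<alpha> u v w" unfolding mem_E by blast
  show ?thesis unfolding x emb_quad by (simp add: quad_def flip: of_real_of_rat)
qed

lemma emb_cnj: "x \<in> E \<Longrightarrow> emb (cnj \<theta>) x = cnj (emb \<theta> x)"
proof -
  have "cnj (of_rat u) = of_rat u" for u
    by (cases u) (simp add: of_rat_rat)
  moreover assume "x \<in> E"
  then obtain u v w where x: "x = quad \<alpha> u v w" unfolding mem_E by blast
  ultimately show ?thesis unfolding x emb_quad by (simp add: quad_def)
qed

text \<open>Divide the cubic by t - \<alpha> and solve the remaining real quadratic; the sign of its
  discriminant \<Delta> separates the two alternatives. The roots are distinct because the relevant
  quantities have nonzero coordinates over the basis 1, \<alpha>, \<alpha>^2.\<close>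

lemma conjugates:
  obtains \<alpha>1 \<alpha>2 :: complex where
    "of_real \<alpha> + \<alpha>1 + \<alpha>2 = of_rat p"
    "of_real \<alpha> * \<alpha>1 + of_real \<alpha> * \<alpha>2 + \<alpha>1 * \<alpha>2 = - of_rat q"
    "of_real \<alpha> * \<alpha>1 * \<alpha>2 = of_rat r"
    "\<alpha>1 ^ 3 = quad \<alpha>1 r q p" "\<alpha>2 ^ 3 = quad \<alpha>2 r q p"
    "of_real \<alpha> \<noteq> \<alpha>1" "of_real \<alpha> \<noteq> \<alpha>2" "\<alpha>1 \<noteq> \<alpha>2"
    "(\<exists>x y. \<alpha>1 = of_real x \<and> \<alpha>2 = of_real y) \<or> (\<alpha>2 = cnj \<alpha>1 \<and> \<alpha>1 \<notin> \<real>)"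
proof -
  define P Q R :: real where "P = of_rat p" and "Q = of_rat q" and "R = of_rat r"
  have PQR: "(of_rat p :: complex) = of_real P" "(of_rat q :: complex) = of_real Q" "(of_rat r :: complex) = of_real R"
    by (simp_all add: P_def Q_def R_def of_real_of_rat)
  have cube: "\<alpha> ^ 3 = R + Q * \<alpha> + P * \<alpha>\<^sup>2"
    using minpoly by (simp add: quad_def P_def Q_def R_def)
  define \<Delta> where "\<Delta> = (P - \<alpha>)\<^sup>2 - 4 * (\<alpha>\<^sup>2 - P * \<alpha> - Q)"
  define s where "s = csqrt (of_real \<Delta>)"
  have s2: "s\<^sup>2 = of_real \<Delta>" by (simp add: s_def)
  define \<alpha>1 where "\<alpha>1 = (of_real (P - \<alpha>) + s) / 2"
  define \<alpha>2 where "\<alpha>2 = (of_real (P - \<alpha>) - s) / 2"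
  have sum: "\<alpha>1 + \<alpha>2 = of_real (P - \<alpha>)" by (simp add: \<alpha>1_def \<alpha>2_def field_simps)
  have "\<alpha>1 * \<alpha>2 = ((of_real (P - \<alpha>))\<^sup>2 - s\<^sup>2) / 4"
    by (simp add: \<alpha>1_def \<alpha>2_def field_simps power2_eq_square)
  also have "\<dots> = of_real (((P - \<alpha>)\<^sup>2 - \<Delta>) / 4)" unfolding s2 by simp
  also have "((P - \<alpha>)\<^sup>2 - \<Delta>) / 4 = \<alpha>\<^sup>2 - P * \<alpha> - Q" by (simp add: \<Delta>_def)
  finally have prod: "\<alpha>1 * \<alpha>2 = of_real (\<alpha>\<^sup>2 - P * \<alpha> - Q)" .
  have 1: "of_real \<alpha> + \<alpha>1 + \<alpha>2 = of_rat p"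
    using sum by (simp add: PQR add.assoc)
  have "of_real \<alpha> * \<alpha>1 + of_real \<alpha> * \<alpha>2 + \<alpha>1 * \<alpha>2 = of_real \<alpha> * (\<alpha>1 + \<alpha>2) + \<alpha>1 * \<alpha>2"
    by (simp add: algebra_simps)
  also have "\<dots> = of_real (\<alpha> * (P - \<alpha>) + (\<alpha>\<^sup>2 - P * \<alpha> - Q))" unfolding sum prod by simp
  also have "\<alpha> * (P - \<alpha>) + (\<alpha>\<^sup>2 - P * \<alpha> - Q) = - Q" by (simp add: algebra_simps power2_eq_square)
  finally have 2: "of_real \<alpha> * \<alpha>1 + of_real \<alpha> * \<alpha>2 + \<alpha>1 * \<alpha>2 = - of_rat q" by (simp add: PQR)
  have "of_real \<alpha> * \<alpha>1 * \<alpha>2 = of_real (\<alpha> * (\<alpha>\<^sup>2 - P * \<alpha> - Q))"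
    unfolding mult.assoc prod by simp
  also have "\<alpha> * (\<alpha>\<^sup>2 - P * \<alpha> - Q) = R"
    using cube by (simp add: algebra_simps power2_eq_square power3_eq_cube)
  finally have 3: "of_real \<alpha> * \<alpha>1 * \<alpha>2 = of_rat r" by (simp add: PQR)
  have q: "of_rat q = - (of_real \<alpha> * \<alpha>1 + of_real \<alpha> * \<alpha>2 + \<alpha>1 * \<alpha>2)" unfolding 2 by simp
  have root: "t ^ 3 = quad t r q p" if "t = \<alpha>1 \<or> t = \<alpha>2" for t
  proof -
    have "t ^ 3 - quad t r q p = (t - of_real \<alpha>) * (t - \<alpha>1) * (t - \<alpha>2)"
      unfolding quad_def 1[symmetric] 3[symmetric] q
      by (simp add: algebra_simps power2_eq_square power3_eq_cube)
    then show ?thesis using that by auto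
  qed
  \<comment> \<open>The derivative of the cubic at \<alpha>, nonzero because its leading coordinate
    is 3.\<close>
  have deriv: "(of_real \<alpha> - \<alpha>1) * (of_real \<alpha> - \<alpha>2) = of_real (quad \<alpha> (- q) (- 2 * p) 3)"
  proof -
    have "(of_real \<alpha> - \<alpha>1) * (of_real \<alpha> - \<alpha>2) = of_real \<alpha> * of_real \<alpha> - of_real \<alpha> * (\<alpha>1 + \<alpha>2) + \<alpha>1 * \<alpha>2"
      by (simp add: algebra_simps)
    also have "\<dots> = of_real (\<alpha> * \<alpha> - \<alpha> * (P - \<alpha>) + (\<alpha>\<^sup>2 - P * \<alpha> - Q))"
      unfolding sum prod by simp
    also have "\<alpha> * \<alpha> - \<alpha> * (P - \<alpha>) + (\<alpha>\<^sup>2 - P * \<alpha> - Q) = quad \<alpha> (- q) (- 2 * p) 3"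
      by (simp add: quad_def P_def Q_def of_rat_minus of_rat_mult algebra_simps power2_eq_square)
    finally show ?thesis .
  qed
  have "quad \<alpha> (- q) (- 2 * p) 3 \<noteq> 0" using quad_eq_0[of "- q" "- 2 * p" 3] by auto
  then have ne: "of_real \<alpha> \<noteq> \<alpha>1" "of_real \<alpha> \<noteq> \<alpha>2" using deriv by auto
  \<comment> \<open>Again the coordinate of \<alpha>^2, here -3, rules out zero.\<close>
  have "\<Delta> = quad \<alpha> (p\<^sup>2 + 4 * q) (2 * p) (- 3)"
    by (simp add: \<Delta>_def quad_def P_def Q_def of_rat_add of_rat_minus of_rat_mult of_rat_power algebra_simps power2_eq_square)
  then have \<Delta>0: "\<Delta> \<noteq> 0" using quad_eq_0[of "p\<^sup>2 + 4 * q" "2 * p" "- 3"] by auto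
  then have "s \<noteq> 0" using s2 by auto
  then have ne12: "\<alpha>1 \<noteq> \<alpha>2" by (simp add: \<alpha>1_def \<alpha>2_def)
  have "(\<exists>x y. \<alpha>1 = of_real x \<and> \<alpha>2 = of_real y) \<or> (\<alpha>2 = cnj \<alpha>1 \<and> \<alpha>1 \<notin> \<real>)"
  proof (cases "\<Delta> > 0")
    case True
    then have "s = of_real (sqrt \<Delta>)" unfolding s_def by (simp add: csqrt_of_real_nonneg)
    then have "\<alpha>1 = of_real ((P - \<alpha> + sqrt \<Delta>) / 2)" "\<alpha>2 = of_real ((P - \<alpha> - sqrt \<Delta>) / 2)"
      by (simp_all add: \<alpha>1_def \<alpha>2_def)
    then show ?thesis by blast
  next
    case False
    then have "s = \<i> * of_real (sqrt (- \<Delta>))" unfolding s_def by (simp add: csqrt_of_real_nonpos)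
    moreover have "sqrt (- \<Delta>) \<noteq> 0" using \<Delta>0 by simp
    ultimately show ?thesis
      by (auto simp: \<alpha>1_def \<alpha>2_def complex_is_Real_iff complex_eq_iff)
  qed
  with 1 2 3 root[of \<alpha>1] root[of \<alpha>2] ne ne12 show ?thesis by (intro that) simp_all
qed

text \<open>A real root other than \<alpha> would give a second real embedding, which differs from
  the inclusion at \<alpha>.\<close>

lemma one_real_embedding_conjugates:
  assumes "one_real_embedding E" "\<theta> ^ 3 = quad \<theta> r q p" "\<theta> \<noteq> complex_of_real \<alpha>"
  shows "\<theta> \<notin> \<real>"
proof
  assume "\<theta> \<in> \<real>"
  then obtain x where x: "\<theta> = of_real x" by (auto elim: Reals_cases)
  have "quad (complex_of_real x) r q p = of_real (quad x r q p)"
    by (simp add: quad_def of_real_of_rat)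
  then have "x ^ 3 = quad x r q p"
    using assms(2) unfolding x by (simp flip: of_real_power)
  then have "{emb x, emb \<alpha>} \<subseteq> (embeddings E :: (real \<Rightarrow> real) set)"
    using emb_embeddings[of x] emb_embeddings[OF minpoly] by simp
  moreover obtain f where "(embeddings E :: (real \<Rightarrow> real) set) = {f}"
    using assms(1)[unfolded one_real_embedding_def] by (rule card_1_singletonE)
  ultimately have "emb x = emb \<alpha>" by auto
  then have "emb x \<alpha> = emb \<alpha> \<alpha>" by simp
  then have "x = \<alpha>" by (simp only: emb_alpha)
  then show False using assms(3) x by simp
qed

lemma totally_real_conjugates:
  fixes \<theta> :: complex
  assumes "totally_real E" "\<theta> ^ 3 = quad \<theta> r q p"
  shows "\<theta> \<in> \<real>"
proof -
  have \<alpha>: "\<alpha> \<in> E" using quad_E[of 0 1 0] by (simp add: quad_def)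
  have "emb \<theta> ` E \<subseteq> \<real>"
    using assms(1) emb_embeddings[OF assms(2)] by (simp add: totally_real_def)
  from subsetD[OF this imageI[OF \<alpha>]] have "emb \<theta> \<alpha> \<in> \<real>" .
  then show ?thesis by (simp add: emb_alpha)
qed

end

lemma common_denominator:
  assumes "finite (S :: rat set)"
  shows "\<exists>d :: int. d > 0 \<and> (\<forall>s\<in>S. \<exists>k :: int. of_int d * s = of_int k)"
  using assms
proof (induction S)
  case empty
  then show ?case by (intro exI[of _ 1]) auto
next
  case (insert x S)
  then obtain d :: int where d: "d > 0" "\<forall>s\<in>S. \<exists>k :: int. of_int d * s = of_int k" by blast
  obtain n e :: int where e: "quotient_of x = (n, e)" by force
  then have x: "x = of_int n / of_int e" "e > 0"
    using quotient_of_div quotient_of_denom_pos by auto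
  have "\<exists>k :: int. of_int (d * e) * s = of_int k" if s: "s \<in> insert x S" for s
  proof (cases "s = x")
    case True
    then have "of_int (d * e) * s = of_int (d * n)" using x by simp
    then show ?thesis by blast
  next
    case False
    then obtain k where "of_int d * s = of_int k" using s d by blast
    then have "of_int (d * e) * s = of_int (e * k)" by simp
    then show ?thesis by blast
  qed
  then show ?case using d x by (intro exI[of _ "d * e"]) auto
qed

text \<open>\<open>F\<close> stands for \<open>\<psi>\<close> and \<open>\<psi>\<^sup>2\<close> respectively.\<close>

definition approximable :: "real \<Rightarrow> real \<Rightarrow> (nat \<Rightarrow> real) \<Rightarrow> bool"
  where "approximable \<alpha> \<beta> F \<longleftrightarrow>
    (\<exists>C > 0. \<exists>C' > 0. \<forall>\<epsilon>::real. \<forall>D::nat. 0 < \<epsilon> \<and> \<epsilon> \<le> 1 \<and> D > 0 \<longrightarrow>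
         (\<exists>Q R S :: int. Q > 1 \<and> Gcd {Q, R, S} = 1
            \<and> \<bar>of_int Q * \<alpha> - of_int R\<bar> \<le> \<epsilon> * of_int Q powr (-1/2)
            \<and> \<bar>of_int Q * \<beta> - of_int S\<bar> \<le> C * of_int Q powr (-1/2)
            \<and> [Q = 0] (mod int D) \<and> [R = 0] (mod int D)
            \<and> ln (of_int Q) \<le> C' * inverse \<epsilon> * F D))"

lemma (in cubic_approx) approximable:
  assumes units: "\<And>K. K \<ge> 1 \<Longrightarrow> \<exists>C>0. \<forall>\<delta> D. 0 < \<delta> \<and> \<delta> \<le> 1 \<and> D > 0 \<longrightarrow>
    (\<exists>\<eta>. approx_unit K D \<delta> \<eta> \<and> ln \<bar>\<eta>\<bar> \<le> C / \<delta> * F D)"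
    and F: "\<And>D. D > 0 \<Longrightarrow> F D \<ge> 1"
  shows "approximable \<alpha> \<beta> F"
proof -
  obtain K A W where K: "K \<ge> 1" and A: "A > 0" and W: "W \<ge> 1"
    and approx: "\<And>\<eta> D \<delta>. approx_unit K D \<delta> \<eta> \<Longrightarrow> \<exists>Q R S :: int. Q > 1 \<and> Gcd {Q, R, S} = 1
      \<and> \<bar>of_int Q * \<alpha> - of_int R\<bar> \<le> A * \<delta> * of_int Q powr (-1/2)
      \<and> \<bar>of_int Q * \<beta> - of_int S\<bar> \<le> A * of_int Q powr (-1/2)
      \<and> [Q = 0] (mod int D) \<and> [R = 0] (mod int D)
      \<and> ln (of_int Q) \<le> ln W + ln \<bar>\<eta>\<bar>"
    using approximation by blast
  obtain C where C: "C > 0" and unit: "\<And>\<delta> D. 0 < \<delta> \<Longrightarrow> \<delta> \<le> 1 \<Longrightarrow> D > 0 \<Longrightarrow>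
      \<exists>\<eta>. approx_unit K D \<delta> \<eta> \<and> ln \<bar>\<eta>\<bar> \<le> C / \<delta> * F D"
    using units[OF K] by blast
  \<comment> \<open>C (1 + A) absorbs the passage from \<delta> to \<epsilon>; \<open>ln W\<close>
    is absorbed because F D / \<epsilon> \<ge> 1.\<close>
  define C' where "C' = ln W + C * (1 + A)"
  have C': "C' > 0" unfolding C'_def using W C A by (intro add_nonneg_pos mult_pos_pos) auto
  have "\<exists>Q R S :: int. Q > 1 \<and> Gcd {Q, R, S} = 1
            \<and> \<bar>of_int Q * \<alpha> - of_int R\<bar> \<le> \<epsilon> * of_int Q powr (-1/2)
            \<and> \<bar>of_int Q * \<beta> - of_int S\<bar> \<le> A * of_int Q powr (-1/2)
            \<and> [Q = 0] (mod int D) \<and> [R = 0] (mod int D)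
            \<and> ln (of_int Q) \<le> C' * inverse \<epsilon> * F D" if \<epsilon>: "0 < \<epsilon>" "\<epsilon> \<le> 1" and D: "D > 0" for \<epsilon> D
  proof -
    \<comment> \<open>Dividing by 1 + A rather than A keeps \<delta> \<le> 1 as well as A \<delta>
      \<le> \<epsilon>.\<close>
    define \<delta> where "\<delta> = \<epsilon> / (1 + A)"
    have \<delta>: "0 < \<delta>" "\<delta> \<le> 1" using \<epsilon> A by (simp_all add: \<delta>_def)
    have "A * \<delta> = \<epsilon> * (A / (1 + A))" by (simp add: \<delta>_def)
    also have "\<dots> \<le> \<epsilon> * 1" using \<epsilon> A by (intro mult_left_mono) auto
    finally have A\<delta>: "A * \<delta> \<le> \<epsilon>" by simp
    obtain \<eta> where \<eta>: "approx_unit K D \<delta> \<eta>" "ln \<bar>\<eta>\<bar> \<le> C / \<delta> * F D"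
      using unit[OF \<delta> D] by blast
    obtain Q R S :: int where QRS: "Q > 1" "Gcd {Q, R, S} = 1"
      "\<bar>of_int Q * \<alpha> - of_int R\<bar> \<le> A * \<delta> * of_int Q powr (-1/2)"
      "\<bar>of_int Q * \<beta> - of_int S\<bar> \<le> A * of_int Q powr (-1/2)"
      "[Q = 0] (mod int D)" "[R = 0] (mod int D)"
      "ln (of_int Q) \<le> ln W + ln \<bar>\<eta>\<bar>"
      using approx[OF \<eta>(1)] by blast
    have "A * \<delta> * of_int Q powr (-1/2) \<le> \<epsilon> * of_int Q powr (-1/2)"
      using A\<delta> by (intro mult_right_mono) auto
    with QRS(3) have R: "\<bar>of_int Q * \<alpha> - of_int R\<bar> \<le> \<epsilon> * of_int Q powr (-1/2)" by linarith
    have "1 * 1 \<le> inverse \<epsilon> * F D" using \<epsilon> F[OF D] by (intro mult_mono) (auto simp: one_le_inverse)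
    then have "ln W * 1 \<le> ln W * (inverse \<epsilon> * F D)" using W by (intro mult_left_mono) auto
    moreover have "C / \<delta> * F D = C * (1 + A) * (inverse \<epsilon> * F D)"
      by (simp add: \<delta>_def divide_inverse)
    ultimately have "ln (of_int Q) \<le> C' * inverse \<epsilon> * F D"
      using QRS(7) \<eta>(2) by (simp add: C'_def algebra_simps)
    with QRS R show ?thesis by blast
  qed
  then show ?thesis unfolding approximable_def using A C' by blast
qed

section \<open>Fields with a given basis 1, \<alpha>, \<beta>\<close>

locale cubic_field_basis =
  fixes E :: "real set" and \<alpha> \<beta> :: real
  assumes span: "x \<in> E \<longleftrightarrow> (\<exists>u v w. x = of_rat u + of_rat v * \<alpha> + of_rat w * \<beta>)"
    and indep: "of_rat u + of_rat v * \<alpha> + of_rat w * \<beta> = 0 \<Longrightarrow> u = 0 \<and> v = 0 \<and> w = 0"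
    and mult: "x \<in> E \<Longrightarrow> y \<in> E \<Longrightarrow> x * y \<in> E"
    and inverse: "x \<in> E \<Longrightarrow> x \<noteq> 0 \<Longrightarrow> inverse x \<in> E"
begin

lemma basis_E: "\<alpha> \<in> E" "\<beta> \<in> E"
proof -
  have "of_rat u + of_rat v * \<alpha> + of_rat w * \<beta> \<in> E" for u v w
    using span by blast
  from this[of 0 1 0] this[of 0 0 1] show "\<alpha> \<in> E" "\<beta> \<in> E" by simp_all
qed

text \<open>If \<open>\<alpha>\<close> were quadratic, then \<open>\<rat>(\<alpha>)\<close> would be spanned by \<open>1, \<alpha>\<close>, and \<open>\<alpha> \<beta> = u + v \<alpha> + w \<beta>\<close> could be
  solved for \<open>\<beta>\<close> in \<open>\<rat>(\<alpha>)\<close>.\<close>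

lemma square_coord_nonzero:
  assumes "\<alpha>\<^sup>2 = of_rat x + of_rat y * \<alpha> + of_rat z * \<beta>"
  shows "z \<noteq> 0"
proof
  assume z: "z = 0"
  obtain u v w where uvw: "\<alpha> * \<beta> = of_rat u + of_rat v * \<alpha> + of_rat w * \<beta>"
    using mult[OF basis_E] span by blast
  define n where "n = x + w * y - w\<^sup>2"
  have n: "(\<alpha> - of_rat w) * (\<alpha> + of_rat (w - y)) = of_rat n"
    using assms z by (simp add: n_def of_rat_add of_rat_diff of_rat_mult of_rat_power algebra_simps power2_eq_square)
  have "of_rat n * \<beta> = (\<alpha> + of_rat (w - y)) * (\<alpha> * \<beta> - of_rat w * \<beta>)"
    unfolding n[symmetric] by (simp add: algebra_simps)
  also have "\<alpha> * \<beta> - of_rat w * \<beta> = of_rat u + of_rat v * \<alpha>" unfolding uvw by simp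
  also have "(\<alpha> + of_rat (w - y)) * (of_rat u + of_rat v * \<alpha>)
    = of_rat (u * (w - y)) + of_rat (u + v * (w - y)) * \<alpha> + of_rat v * \<alpha>\<^sup>2"
    by (simp add: of_rat_add of_rat_diff of_rat_mult algebra_simps power2_eq_square)
  also have "\<dots> = of_rat (u * (w - y) + v * x) + of_rat (u + v * (w - y) + v * y) * \<alpha>"
    unfolding assms z by (simp add: of_rat_add of_rat_diff of_rat_mult algebra_simps)
  finally have "of_rat (u * (w - y) + v * x) + of_rat (u + v * (w - y) + v * y) * \<alpha> + of_rat (- n) * \<beta> = 0"
    by (simp add: of_rat_minus)
  from indep[OF this] have "n = 0" by simp
  then have "\<alpha> - of_rat w = 0 \<or> \<alpha> + of_rat (w - y) = 0" using n by simp
  then have "of_rat (- w) + of_rat 1 * \<alpha> + of_rat 0 * \<beta> = 0 \<or> of_rat (w - y) + of_rat 1 * \<alpha> + of_rat 0 * \<beta> = 0"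
    by (auto simp: of_rat_minus algebra_simps)
  then show False using indep by (metis one_neq_zero)
qed

text \<open>\<alpha>^2 has a nonzero \<beta>-coordinate, so \<beta> can be exchanged for \<alpha>^2
  in the basis.\<close>

lemma power_basis:
  obtains p q r b0 b1 b2 where "cubic_field E \<alpha> p q r" "\<beta> = quad \<alpha> b0 b1 b2" "b2 \<noteq> 0"
proof -
  obtain x y z where xyz: "\<alpha>\<^sup>2 = of_rat x + of_rat y * \<alpha> + of_rat z * \<beta>"
    using mult[OF basis_E(1) basis_E(1)] span by (auto simp: power2_eq_square)
  have z: "z \<noteq> 0" using square_coord_nonzero[OF xyz] .
  have quad: "quad \<alpha> u v w = of_rat (u + w * x) + of_rat (v + w * y) * \<alpha> + of_rat (w * z) * \<beta>" for u v w
    unfolding quad_def xyz by (simp add: of_rat_add of_rat_mult algebra_simps)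
  have \<beta>: "\<beta> = quad \<alpha> (- x / z) (- y / z) (1 / z)"
    unfolding quad using z by simp
  have mem: "e \<in> E \<longleftrightarrow> (\<exists>u v w. e = quad \<alpha> u v w)" for e
  proof
    assume "e \<in> E"
    then obtain u v w where "e = of_rat u + of_rat v * \<alpha> + of_rat w * \<beta>" using span by blast
    then have "e = quad \<alpha> (u - w * x / z) (v - w * y / z) (w / z)" unfolding quad using z by simp
    then show "\<exists>u v w. e = quad \<alpha> u v w" by blast
  next
    assume "\<exists>u v w. e = quad \<alpha> u v w"
    then show "e \<in> E" unfolding quad span by blast
  qed
  have "\<alpha> ^ 3 \<in> E" using mult basis_E by (simp add: power3_eq_cube)
  then obtain r q p where min: "\<alpha> ^ 3 = quad \<alpha> r q p" using mem by blast
  have "u = 0 \<and> v = 0 \<and> w = 0" if "quad \<alpha> u v w = 0" for u v w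
    using indep[OF that[unfolded quad]] z by auto
  with mem min inverse have "cubic_field E \<alpha> p q r" by unfold_locales blast+
  from that[OF this \<beta>] z show ?thesis by simp
qed

text \<open>\<open>d\<close> clears the denominators of \<alpha>^2 and \<alpha> \<beta>, so d
  \<alpha> maps the lattice into itself, and so does every polynomial in it. The set
  \<open>S\<close> lets the same \<open>d\<close> clear the coefficients of the cubic of
  \<alpha>.\<close>

lemma stable_order:
  assumes "finite S"
  obtains d :: int where "d > 0" "\<And>s. s \<in> S \<Longrightarrow> \<exists>k :: int. of_int d * s = (of_int k :: rat)"
    "\<And>x y. x \<in> cubic_order (of_int d * \<alpha>) \<Longrightarrow> y \<in> lattice3 \<alpha> \<beta> \<Longrightarrow> x * y \<in> lattice3 \<alpha> \<beta>"
proof -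
  obtain x y z where xyz: "\<alpha> * \<alpha> = of_rat x + of_rat y * \<alpha> + of_rat z * \<beta>"
    using mult[OF basis_E(1) basis_E(1)] span by blast
  obtain u v w where uvw: "\<alpha> * \<beta> = of_rat u + of_rat v * \<alpha> + of_rat w * \<beta>"
    using mult[OF basis_E] span by blast
  obtain d :: int where d: "d > 0" "\<And>s. s \<in> S \<union> {x, y, z, u, v, w} \<Longrightarrow> \<exists>k :: int. of_int d * s = (of_int k :: rat)"
    using common_denominator[of "S \<union> {x, y, z, u, v, w}"] assms by auto
  have LI: "of_int i + of_int j * \<alpha> + of_int k * \<beta> \<in> lattice3 \<alpha> \<beta>" for i j k
    by (auto simp: lattice3_def)
  have L_comb: "of_int i * s + of_int j * t \<in> lattice3 \<alpha> \<beta>" if st: "s \<in> lattice3 \<alpha> \<beta>" "t \<in> lattice3 \<alpha> \<beta>" for i j s t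
  proof -
    obtain s1 s2 s3 t1 t2 t3 where "s = of_int s1 + of_int s2 * \<alpha> + of_int s3 * \<beta>" "t = of_int t1 + of_int t2 * \<alpha> + of_int t3 * \<beta>"
      using st by (auto simp: lattice3_def)
    then have "of_int i * s + of_int j * t
      = of_int (i * s1 + j * t1) + of_int (i * s2 + j * t2) * \<alpha> + of_int (i * s3 + j * t3) * \<beta>"
      by (simp add: algebra_simps)
    then show ?thesis using LI by metis
  qed
  have scaled: "of_int d * (of_rat s1 + of_rat s2 * \<alpha> + of_rat s3 * \<beta>) \<in> lattice3 \<alpha> \<beta>"
    if s: "s1 \<in> {x, y, z, u, v, w}" "s2 \<in> {x, y, z, u, v, w}" "s3 \<in> {x, y, z, u, v, w}" for s1 s2 s3
  proof -
    obtain k1 k2 k3 :: int where "of_int d * s1 = of_int k1" "of_int d * s2 = of_int k2" "of_int d * s3 = of_int k3"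
      using d(2) s by (meson UnI2)
    then have "of_int d * of_rat s1 = real_of_int k1" "of_int d * of_rat s2 = real_of_int k2" "of_int d * of_rat s3 = real_of_int k3"
      by (metis of_rat_mult of_rat_of_int_eq)+
    then have "of_int d * (of_rat s1 + of_rat s2 * \<alpha> + of_rat s3 * \<beta>) = of_int k1 + of_int k2 * \<alpha> + of_int k3 * \<beta>"
      by (simp add: distrib_left flip: mult.assoc)
    then show ?thesis using LI by simp
  qed
  define \<gamma> where "\<gamma> = of_int d * \<alpha>"
  have \<gamma>L: "\<gamma> * s \<in> lattice3 \<alpha> \<beta>" if sL: "s \<in> lattice3 \<alpha> \<beta>" for s
  proof -
    obtain i j k where s: "s = of_int i + of_int j * \<alpha> + of_int k * \<beta>" using sL by (auto simp: lattice3_def)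
    have 2: "of_int d * (\<alpha> * \<alpha>) \<in> lattice3 \<alpha> \<beta>" unfolding xyz by (rule scaled) auto
    have 3: "of_int d * (\<alpha> * \<beta>) \<in> lattice3 \<alpha> \<beta>" unfolding uvw by (rule scaled) auto
    have "\<gamma> * s = of_int 1 * (of_int 0 + of_int (d * i) * \<alpha> + of_int 0 * \<beta>)
        + of_int 1 * (of_int j * (of_int d * (\<alpha> * \<alpha>)) + of_int k * (of_int d * (\<alpha> * \<beta>)))"
      unfolding s \<gamma>_def by (simp add: algebra_simps)
    also have "\<dots> \<in> lattice3 \<alpha> \<beta>"
      by (intro L_comb LI 2 3)
    finally show ?thesis .
  qed
  have "t * s \<in> lattice3 \<alpha> \<beta>" if t: "t \<in> cubic_order \<gamma>" and s: "s \<in> lattice3 \<alpha> \<beta>" for t s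
  proof -
    obtain i j k where "t = of_int i + of_int j * \<gamma> + of_int k * \<gamma>\<^sup>2" using t by (rule cubic_orderE)
    then have "t * s = of_int 1 * (of_int i * s + of_int j * (\<gamma> * s)) + of_int k * (\<gamma> * (\<gamma> * s))"
      by (simp add: algebra_simps power2_eq_square)
    also have "\<dots> \<in> lattice3 \<alpha> \<beta>"
      by (intro L_comb \<gamma>L s)
    finally show ?thesis .
  qed
  with d show ?thesis using that unfolding \<gamma>_def by blast
qed

lemma approximations:
  shows "one_real_embedding E \<Longrightarrow> approximable \<alpha> \<beta> psi"
    and "totally_real E \<Longrightarrow> approximable \<alpha> \<beta> (\<lambda>D. (psi D)\<^sup>2)"
proof -
  obtain p q r b0 b1 b2 where cf: "cubic_field E \<alpha> p q r" and \<beta>: "\<beta> = quad \<alpha> b0 b1 b2" and b2: "b2 \<noteq> 0"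
    by (rule power_basis)
  interpret cubic_field E \<alpha> p q r by (rule cf)
  obtain \<alpha>1 \<alpha>2 :: complex where
    sym: "of_real \<alpha> + \<alpha>1 + \<alpha>2 = of_rat p"
      "of_real \<alpha> * \<alpha>1 + of_real \<alpha> * \<alpha>2 + \<alpha>1 * \<alpha>2 = - of_rat q"
      "of_real \<alpha> * \<alpha>1 * \<alpha>2 = of_rat r"
    and cube: "\<alpha>1 ^ 3 = quad \<alpha>1 r q p" "\<alpha>2 ^ 3 = quad \<alpha>2 r q p"
    and ne: "of_real \<alpha> \<noteq> \<alpha>1" "of_real \<alpha> \<noteq> \<alpha>2" "\<alpha>1 \<noteq> \<alpha>2"
    and dich: "(\<exists>x y. \<alpha>1 = of_real x \<and> \<alpha>2 = of_real y) \<or> (\<alpha>2 = cnj \<alpha>1 \<and> \<alpha>1 \<notin> \<real>)"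
    by (rule conjugates)
  obtain d :: int where d: "d > 0" "\<And>s. s \<in> {p, q, r} \<Longrightarrow> \<exists>k :: int. of_int d * s = (of_int k :: rat)"
    and stable: "\<And>x y. x \<in> cubic_order (of_int d * \<alpha>) \<Longrightarrow> y \<in> lattice3 \<alpha> \<beta> \<Longrightarrow> x * y \<in> lattice3 \<alpha> \<beta>"
    using stable_order[of "{p, q, r}"] by (metis finite.emptyI finite_insert)
  obtain p' q' r' :: int where "of_int d * p = of_int p'" "of_int d * q = of_int q'" "of_int d * r = of_int r'"
    using d(2) by (meson insertCI)
  then have "(of_rat (of_int d * p) :: 'a :: field_char_0) = of_rat (of_int p')"
    "(of_rat (of_int d * q) :: 'a) = of_rat (of_int q')" "(of_rat (of_int d * r) :: 'a) = of_rat (of_int r')"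
    by simp_all
  then have pqr: "(of_int d * of_rat p :: 'a :: field_char_0) = of_int p'" "(of_int d * of_rat q :: 'a) = of_int q'"
      "(of_int d * of_rat r :: 'a) = of_int r'"
    by (simp_all add: of_rat_mult)
  define \<gamma> where "\<gamma> = of_int d * \<alpha>"
  have \<gamma>_quad: "\<gamma> = quad \<alpha> 0 (of_int d) 0" by (simp add: \<gamma>_def quad_def)
  have emb_\<gamma>: "emb \<theta> \<gamma> = of_int d * \<theta>" for \<theta> :: complex
    unfolding \<gamma>_quad emb_quad by (simp add: quad_def)
  \<comment> \<open>Scaling the root by d turns p, q, r into d p, d^2 q, d^3 r; with p', q', r' = d
    p, d q, d r these are the three integers shown.\<close>
  have integral: "integral_cubic \<gamma> p' (d * q') (d * d * r')"
  proof
    have "\<gamma> ^ 3 = of_int d ^ 3 * quad \<alpha> r q p" by (simp add: \<gamma>_def minpoly power_mult_distrib)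
    also have "\<dots> = (of_int d * of_rat p) * \<gamma>\<^sup>2 + of_int d * (of_int d * of_rat q) * \<gamma>
        + of_int d * of_int d * (of_int d * of_rat r)"
      by (simp add: quad_def \<gamma>_def algebra_simps power2_eq_square power3_eq_cube)
    finally show "\<gamma> ^ 3 = of_int p' * \<gamma>\<^sup>2 + of_int (d * q') * \<gamma> + of_int (d * d * r')"
      by (simp add: pqr)
  next
    fix x y z :: int
    assume "of_int x + of_int y * \<gamma> + of_int z * \<gamma>\<^sup>2 = 0"
    then have "quad \<alpha> (of_int x) (of_int (y * d)) (of_int (z * d\<^sup>2)) = 0"
      by (simp add: quad_def \<gamma>_def power_mult_distrib mult.assoc of_rat_mult of_rat_power)
    from quad_eq_0[OF this] show "x = 0 \<and> y = 0 \<and> z = 0" using d by simp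
  qed
  interpret integral_cubic \<gamma> p' "d * q'" "d * d * r'" by (rule integral)
  have of_int_E: "of_int n \<in> E" for n
    using quad_E[of "of_int n" 0 0] by (simp add: quad_def)
  have O_E: "\<O> \<subseteq> E"
  proof
    fix x assume "x \<in> \<O>"
    then obtain i j k where "x = of_int i + of_int j * \<gamma> + of_int k * (\<gamma> * \<gamma>)"
      by (auto elim: cubic_orderE simp: power2_eq_square)
    moreover have "\<gamma> \<in> E" unfolding \<gamma>_quad by (rule quad_E)
    ultimately show "x \<in> E" by (auto intro!: add_E mult_E of_int_E)
  qed
  have hom: "inj_ring_hom_on E (emb \<alpha>1)" "inj_ring_hom_on E (emb \<alpha>2)"
    by (rule emb_inj_ring_hom cube)+
  \<comment> \<open>The weights are the cofactors of the Vandermonde matrix along the squares: they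
    annihilate 1 and \<alpha>, and send \<alpha>^2 to the determinant. \<open>g\<close> normalises
    the value at \<beta>, whose coordinate on \<alpha>^2 is \<open>b2\<close>, to 1.\<close>
  define g where "g = 1 / ((of_real \<alpha> - \<alpha>1) * (of_real \<alpha> - \<alpha>2) * (\<alpha>1 - \<alpha>2) * of_rat b2)"
  have g: "g \<noteq> 0" "(of_real \<alpha> - \<alpha>1) * (of_real \<alpha> - \<alpha>2) * (\<alpha>1 - \<alpha>2) * of_rat b2 * g = 1"
    using ne b2 by (simp_all add: g_def)
  define w0 w1 w2 where "w0 = g * (\<alpha>1 - \<alpha>2)" and "w1 = g * (\<alpha>2 - of_real \<alpha>)" and "w2 = g * (of_real \<alpha> - \<alpha>1)"
  have emb_\<beta>: "emb \<theta> \<beta> = of_rat b0 + of_rat b1 * \<theta> + of_rat b2 * \<theta>\<^sup>2" for \<theta> :: complex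
    unfolding \<beta> emb_quad by (simp add: quad_def)
  have \<beta>': "complex_of_real \<beta> = of_rat b0 + of_rat b1 * of_real \<alpha> + of_rat b2 * (of_real \<alpha>)\<^sup>2"
    unfolding \<beta> quad_def by (simp add: of_real_of_rat)
  have "w0 + w1 + w2 = 0" by (simp add: w0_def w1_def w2_def algebra_simps)
  moreover have "w0 * of_real \<alpha> + w1 * emb \<alpha>1 \<alpha> + w2 * emb \<alpha>2 \<alpha> = 0"
    by (simp add: w0_def w1_def w2_def emb_alpha algebra_simps)
  moreover have "w0 * of_real \<beta> + w1 * emb \<alpha>1 \<beta> + w2 * emb \<alpha>2 \<beta>
      = (of_real \<alpha> - \<alpha>1) * (of_real \<alpha> - \<alpha>2) * (\<alpha>1 - \<alpha>2) * of_rat b2 * g"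
    unfolding emb_\<beta> \<beta>' w0_def w1_def w2_def by (simp add: algebra_simps power2_eq_square)
  then have "w0 * of_real \<beta> + w1 * emb \<alpha>1 \<beta> + w2 * emb \<alpha>2 \<beta> = 1" unfolding g(2) .
  moreover have "w0 \<noteq> 0" using ne g by (simp add: w0_def)
  moreover have "of_real \<gamma> + emb \<alpha>1 \<gamma> + emb \<alpha>2 \<gamma> = of_int p'"
  proof -
    have "of_real \<gamma> + emb \<alpha>1 \<gamma> + emb \<alpha>2 \<gamma> = of_int d * (of_real \<alpha> + \<alpha>1 + \<alpha>2)"
      unfolding emb_\<gamma> by (simp add: \<gamma>_def algebra_simps)
    then show ?thesis unfolding sym pqr .
  qed
  moreover have "of_real \<gamma> * emb \<alpha>1 \<gamma> + of_real \<gamma> * emb \<alpha>2 \<gamma> + emb \<alpha>1 \<gamma> * emb \<alpha>2 \<gamma> = - of_int (d * q')"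
  proof -
    have "of_real \<gamma> * emb \<alpha>1 \<gamma> + of_real \<gamma> * emb \<alpha>2 \<gamma> + emb \<alpha>1 \<gamma> * emb \<alpha>2 \<gamma>
        = of_int d * of_int d * (of_real \<alpha> * \<alpha>1 + of_real \<alpha> * \<alpha>2 + \<alpha>1 * \<alpha>2)"
      unfolding emb_\<gamma> by (simp add: \<gamma>_def algebra_simps)
    also have "\<dots> = - (of_int d * (of_int d * of_rat q))" unfolding sym by simp
    finally show ?thesis unfolding pqr by simp
  qed
  moreover have "of_real \<gamma> * emb \<alpha>1 \<gamma> * emb \<alpha>2 \<gamma> = of_int (d * d * r')"
  proof -
    have "of_real \<gamma> * emb \<alpha>1 \<gamma> * emb \<alpha>2 \<gamma> = of_int d * of_int d * (of_int d * (of_real \<alpha> * \<alpha>1 * \<alpha>2))"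
      unfolding emb_\<gamma> by (simp add: \<gamma>_def algebra_simps)
    then show ?thesis unfolding sym pqr by simp
  qed
  moreover have "inj_ring_hom_on \<O> complex_of_real" by (auto simp: inj_ring_hom_on_def)
  ultimately interpret cubic_approx \<gamma> p' "d * q'" "d * d * r'" "emb \<alpha>1" "emb \<alpha>2" E \<alpha> \<beta> w0 w1 w2
    using hom inj_ring_hom_on_subset[OF _ O_E] add_E mult_E O_E basis_E stable[folded \<gamma>_def]
    by unfold_locales auto
  have psi1: "psi D \<ge> 1" if "D > 0" for D
    using psi_nat_pos[OF that] by (simp add: psi_eq)
  show "approximable \<alpha> \<beta> psi" if one: "one_real_embedding E"
  proof (rule approximable)
    have "\<alpha>1 \<notin> \<real>" using one_real_embedding_conjugates[OF one cube(1)] ne by simp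
    then have "\<alpha>2 = cnj \<alpha>1" using dich by auto
    then have cnj: "emb \<alpha>2 x = cnj (emb \<alpha>1 x)" if "x \<in> \<O>" for x
      using emb_cnj O_E that by blast
    show "\<exists>C>0. \<forall>\<delta> D. 0 < \<delta> \<and> \<delta> \<le> 1 \<and> D > 0 \<longrightarrow>
      (\<exists>\<eta>. approx_unit K D \<delta> \<eta> \<and> ln \<bar>\<eta>\<bar> \<le> C / \<delta> * psi D)" if "K \<ge> 1" for K
      unfolding psi_eq by (rule approx_unit_complex[OF refl cnj that]) blast+
  qed (rule psi1)
  show "approximable \<alpha> \<beta> (\<lambda>D. (psi D)\<^sup>2)" if tr: "totally_real E"
  proof (rule approximable)
    have "\<alpha>1 \<in> \<real>" "\<alpha>2 \<in> \<real>" using totally_real_conjugates[OF tr] cube by blast+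
    then have re: "emb \<alpha>1 x \<in> \<real>" "emb \<alpha>2 x \<in> \<real>" if "x \<in> \<O>" for x
      using emb_of_real O_E that by (auto elim!: Reals_cases)
    show "\<exists>C>0. \<forall>\<delta> D. 0 < \<delta> \<and> \<delta> \<le> 1 \<and> D > 0 \<longrightarrow>
      (\<exists>\<eta>. approx_unit K D \<delta> \<eta> \<and> ln \<bar>\<eta>\<bar> \<le> C / \<delta> * (psi D)\<^sup>2)" if "K \<ge> 1" for K
      unfolding psi_eq by (rule approx_unit_real[OF refl re that]) blast+
    show "(psi D)\<^sup>2 \<ge> 1" if "D > 0" for D
      using psi1[OF that] by simp
  qed
qed

end

text \<open>Independence of a list puts each vector outside the span of the later ones, so the
  coefficients of a relation are shown to vanish from left to right.\<close>

lemma cubic_field_basis_of_rat_basis: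
  assumes "cubic_number_field E" "rat_basis [1, \<alpha>, \<beta>] E"
  shows "cubic_field_basis E \<alpha> \<beta>"
proof -
  interpret R: ring "ring_of_type_algebra :: real ring" by rule
  have carrier: "carrier (ring_of_type_algebra :: real ring) = UNIV"
    and ops: "x \<otimes>\<^bsub>ring_of_type_algebra\<^esub> y = x * y" "x \<oplus>\<^bsub>ring_of_type_algebra\<^esub> y = x + y"
      "\<zero>\<^bsub>ring_of_type_algebra\<^esub> = (0 :: real)" "\<one>\<^bsub>ring_of_type_algebra\<^esub> = (1 :: real)" for x y :: real
    by (simp_all add: ring_of_type_algebra_def)
  have line: "x \<in> R.line_extension \<rat> a S \<longleftrightarrow> (\<exists>k. \<exists>s\<in>S. x = of_rat k * a + s)" for x a S
    unfolding R.line_extension_mem_iff ops Rats_def by auto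
  have sub: "subfield E ring_of_type_algebra"
    using assms(1) by (simp add: cubic_number_field_def)
  have ind: "R.independent \<rat> [1, \<alpha>, \<beta>]" and span: "R.Span \<rat> [1, \<alpha>, \<beta>] = E"
    using assms(2) by (simp_all add: rat_basis_def)
  have span2: "x \<in> R.Span \<rat> [\<alpha>, \<beta>] \<longleftrightarrow> (\<exists>v w. x = of_rat v * \<alpha> + of_rat w * \<beta>)" for x
    by (simp add: line ops Bex_def) metis
  have span1: "x \<in> R.Span \<rat> [\<beta>] \<longleftrightarrow> (\<exists>w. x = of_rat w * \<beta>)" for x
    by (auto simp: line ops)
  have span0: "x \<in> R.Span \<rat> [] \<longleftrightarrow> x = 0" for x
    by (simp add: ops)
  note ind' = R.independent_backwards[of \<rat>]
  have ni: "1 \<notin> R.Span \<rat> [\<alpha>, \<beta>]" "\<alpha> \<notin> R.Span \<rat> [\<beta>]" "\<beta> \<notin> R.Span \<rat> []"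
    using ind'(1)[OF ind] ind'(1)[OF ind'(2)[OF ind]] ind'(1)[OF ind'(2)[OF ind'(2)[OF ind]]] by auto
  show ?thesis
  proof
    show "x \<in> E \<longleftrightarrow> (\<exists>u v w. x = of_rat u + of_rat v * \<alpha> + of_rat w * \<beta>)" for x
      unfolding span[symmetric] by (simp add: line ops Bex_def add.assoc) metis
    show "x * y \<in> E" if "x \<in> E" "y \<in> E" for x y
      using subringE(6)[OF subfieldE(1)[OF sub] that] by (simp add: ops)
    show "inverse x \<in> E" if "x \<in> E" "x \<noteq> 0" for x
    proof -
      have "x \<in> E - {\<zero>\<^bsub>ring_of_type_algebra\<^esub>}" using that by (simp add: ops)
      from R.subfield_m_inv[OF sub this] obtain y where "y \<in> E" "x * y = 1" by (auto simp: ops)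
      then show ?thesis by (metis inverse_unique)
    qed
    show "u = 0 \<and> v = 0 \<and> w = 0" if z: "of_rat u + of_rat v * \<alpha> + of_rat w * \<beta> = 0" for u v w
    proof -
      have u: "u = 0"
      proof (rule ccontr)
        assume "u \<noteq> 0"
        then have "1 = of_rat (- v / u) * \<alpha> + of_rat (- w / u) * \<beta>"
          using z by (simp add: of_rat_divide of_rat_minus field_simps)
        then show False using ni(1) span2 by blast
      qed
      have v: "v = 0"
      proof (rule ccontr)
        assume "v \<noteq> 0"
        then have "\<alpha> = of_rat (- w / v) * \<beta>"
          using z u by (simp add: of_rat_divide of_rat_minus field_simps)
        then show False using ni(2) span1 by blast
      qed
      have "w = 0" using z u v ni(3) span0 by auto
      with u v show ?thesis by simp
    qed
  qed
qed

theorem theorem1p5: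
  fixes E :: "real set" and \<alpha> \<beta> :: real
  assumes "cubic_number_field E"
    and "\<alpha> \<in> E" and "\<beta> \<in> E"
    and "rat_basis [1, \<alpha>, \<beta>] E"
  shows
    "(one_real_embedding E \<longrightarrow>
       (\<exists>C > 0. \<exists>C' > 0. \<forall>\<epsilon>::real. \<forall>D::nat. 0 < \<epsilon> \<and> \<epsilon> \<le> 1 \<and> D > 0 \<longrightarrow>
         (\<exists>Q R S :: int. Q > 1 \<and> Gcd {Q, R, S} = 1
            \<and> \<bar>of_int Q * \<alpha> - of_int R\<bar> \<le> \<epsilon> * of_int Q powr (-1/2)
            \<and> \<bar>of_int Q * \<beta> - of_int S\<bar> \<le> C * of_int Q powr (-1/2)
            \<and> [Q = 0] (mod int D) \<and> [R = 0] (mod int D)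
            \<and> ln (of_int Q) \<le> C' * inverse \<epsilon> * psi D)))
     \<and>
     (totally_real E \<longrightarrow>
       (\<exists>C > 0. \<exists>C' > 0. \<forall>\<epsilon>::real. \<forall>D::nat. 0 < \<epsilon> \<and> \<epsilon> \<le> 1 \<and> D > 0 \<longrightarrow>
         (\<exists>Q R S :: int. Q > 1 \<and> Gcd {Q, R, S} = 1
            \<and> \<bar>of_int Q * \<alpha> - of_int R\<bar> \<le> \<epsilon> * of_int Q powr (-1/2)
            \<and> \<bar>of_int Q * \<beta> - of_int S\<bar> \<le> C * of_int Q powr (-1/2)
            \<and> [Q = 0] (mod int D) \<and> [R = 0] (mod int D)
            \<and> ln (of_int Q) \<le> C' * inverse \<epsilon> * (psi D)\<^sup>2)))"
proof -
  interpret cubic_field_basis E \<alpha> \<beta>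
    using assms(1,4) by (rule cubic_field_basis_of_rat_basis)
  show ?thesis
    using approximations unfolding approximable_def by (intro conjI impI)
qed

end
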